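(* Let $X$ be a directed partially ordered vector space with the Riesz decomposition property, and let $Y$ be a Dedekind complete vector lattice. Then $$\operatorname{L}_{\operatorname{b}}^{o_1}(X,Y)=\operatorname{L}_{\operatorname{b}}^{o_2}(X,Y)=\operatorname{L}_{\operatorname{b}}^{o_3}(X,Y)=\operatorname{L}_{\operatorname{b}}^{\tau_o}(X,Y)=\operatorname{L}_{+}^{\operatorname{oc}}(X,Y)-\operatorname{L}_{+}^{\operatorname{oc}}(X,Y).$$ Moreover, $\operatorname{L}_{\operatorname{b}}^{\tau_o}(X,Y)$ is an order closed ideal in $\operatorname{L}_{\operatorname{b}}(X,Y)$.
   Context: Nets are indexed by non-empty upward directed partially ordered sets. For a net in a partially ordered set $P$, $x_\alpha\downarrow x$ means that $x_\alpha\le x_\beta$ whenever $\alpha\ge\beta$ and $\inf_\alpha x_\alpha=x$; $x_\alpha\uparrow x$ is defined dually. $A_{\ge\alpha_0}:=\{\alpha\in A;\ \alpha\ge\alpha_0\}$, and $[a,b]:=\{z\in P;\ a\le z\le b\}$. Order convergence in a partially ordered set $P$, for a net $(x_\alpha)_{\alpha\in A}$ and $x\in P$: - $x_\alpha\xrightarrow{o_1}x$ if there are nets $(\hat x_\alpha)_{\alpha\in A}$, $(\check x_\alpha)_{\alpha\in A}$ in $P$ with $\hat x_\alpha\uparrow x$, $\check x_\alpha\downarrow x$ and $\hat x_\alpha\le x_\alpha\le\check x_\alpha$ for all $\alpha\in A$. - $x_\alpha\xrightarrow{o_2}x$ if there are such nets $(\hat x_\alpha)_{\alpha\in A}$, $(\check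 x_\alpha)_{\alpha\in A}$ with $\hat x_\alpha\uparrow x$, $\check x_\alpha\downarrow x$, and $\alpha_0\in A$ with $\hat x_\alpha\le x_\alpha\le\check x_\alpha$ for all $\alpha\in A_{\ge\alpha_0}$. - $x_\alpha\xrightarrow{o_3}x$ if there are nets $(\hat x_\beta)_{\beta\in B}$, $(\check x_\gamma)_{\gamma\in C}$ in $P$ and a map $\eta\colon B\times C\to A$ with $\hat x_\beta\uparrow x$, $\check x_\gamma\downarrow x$ and $\hat x_\beta\le x_\alpha\le\check x_\gamma$ for all $\beta\in B$, $\gamma\in C$, $\alpha\in A_{\ge\eta(\beta,\gamma)}$. Order topology: $U\subseteq P$ is a net catching set for $x\in P$ if for all nets $(\hat x_\alpha)_{\alpha\in A}$, $(\check x_\alpha)_{\alpha\in A}$ in $P$ (same index set) with $\hat x_\alpha\uparrow x$ and $\check x_\alpha\downarrow x$ there is $\alpha\in A$ with $[\hat x_\alpha,\check x_\alpha]\subseteq U$. $O\subseteq P$ is order open if it is a net catching set for each of its points, and order closed if its complement is order open; the order open sets form the order topology $\tau_o(P)$. A map $f$ between partially ordered sets is $o_i$-continuous if $x_\alpha\xrightarrow{o_i}x$ always implies $f(x_\alpha)\xrightarrow{o_i}f(x)$; it is order continuous if it is continuous with respect to the order topologies; it is order bounded if it maps order bounded sets to order bounded sets. A partially ordered vector space is a real vector space with a translation invariant partial order such that $\lambda x\ge0$ whenever $\lambda\in\mathbb R_+$ and $x\in X_+:=\{x\in X;\ x\ge0\}$; it is a vector lattice if it is a lattice. A partially ordered set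 is directed if any two elements have a common upper bound. $X$ has the Riesz decomposition property if for all $x,y\in X_+$ and $w\in[0,x+y]$ there are $u\in[0,x]$, $v\in[0,y]$ with $w=u+v$. A lattice is Dedekind complete if every non-empty set bounded above has a supremum and every non-empty set bounded below has an infimum. A subset $M$ of a partially ordered set is full if $[x,y]\subseteq M$ for all $x,y\in M$. An ideal is a directed full subgroup (with respect to addition). $\operatorname{L}_{\operatorname{b}}(X,Y)$ is the partially ordered vector space of all order bounded linear operators $X\to Y$, ordered by $S\le T$ iff $S(x)\le T(x)$ for all $x\in X_+$. $\operatorname{L}_{\operatorname{b}}^{o_i}(X,Y)$ and $\operatorname{L}_{\operatorname{b}}^{\tau_o}(X,Y)$ are the sets of $o_i$-continuous, respectively order continuous, operators in $\operatorname{L}_{\operatorname{b}}(X,Y)$. $\operatorname{L}_+^{\operatorname{oc}}(X,Y)$ is the set of all monotone order continuous linear operators $X\to Y$ (for monotone additive maps order continuity and $o_i$-continuity are equivalent for each $i$). $M-N=\{m-n;\ m\in M,n\in N\}$. *)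

theory Defs
  imports
    "HOL-Analysis.Analysis"
    "HOL-Algebra.Order"
    "HOL-Library.Function_Algebras"
begin

section \<open>Partially ordered sets\<close>

text \<open>
  A partially ordered set is a \<^typ>\<open>'p gorder\<close> satisfying \<^locale>\<open>partial_order\<close>, so that
  types of class \<^class>\<open>order\<close>, index sets of nets and spaces of operators are treated uniformly.
\<close>

definition type_poset :: "'a::order gorder" where
  "type_poset = \<lparr>carrier = UNIV, eq = (=), le = (\<le>)\<rparr>"

definition is_sup :: "'p gorder \<Rightarrow> 'p set \<Rightarrow> 'p \<Rightarrow> bool" where
  "is_sup P S x \<longleftrightarrow> least P x (Upper P S)"

definition is_inf :: "'p gorder \<Rightarrow> 'p set \<Rightarrow> 'p \<Rightarrow> bool" where
  "is_inf P S x \<longleftrightarrow> greatest P x (Lower P S)"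

definition directed_in :: "'p gorder \<Rightarrow> 'p set \<Rightarrow> bool" where
  "directed_in P M \<longleftrightarrow> (\<forall>x\<in>M. \<forall>y\<in>M. \<exists>z\<in>M. x \<sqsubseteq>\<^bsub>P\<^esub> z \<and> y \<sqsubseteq>\<^bsub>P\<^esub> z)"

definition full_in :: "'p gorder \<Rightarrow> 'p set \<Rightarrow> bool" where
  "full_in P M \<longleftrightarrow> (\<forall>x\<in>M. \<forall>y\<in>M. \<lbrace>x..y\<rbrace>\<^bsub>P\<^esub> \<subseteq> M)"

section \<open>Nets and order convergence\<close>

text \<open>
  HOL cannot quantify over types inside a formula, so a quantification over all nets ranges over
  the nets whose index set is a partially ordered set in some type \<^typ>\<open>'i\<close>, which plays the role
  of a universe. It is a type parameter of all notions below that quantify over nets. A universe that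
  is too small has too few nets (over a one-element type all of them are constant), so results have
  to assume that \<^typ>\<open>'i\<close> is large enough, and are to be read for all such \<^typ>\<open>'i\<close>.
\<close>

definition index_set :: "'i gorder \<Rightarrow> bool" where
  "index_set I \<longleftrightarrow> partial_order I \<and> carrier I \<noteq> {} \<and> directed_in I (carrier I)"

definition net_in :: "'p gorder \<Rightarrow> 'i gorder \<Rightarrow> ('i \<Rightarrow> 'p) \<Rightarrow> bool" where
  "net_in P I x \<longleftrightarrow> index_set I \<and> x \<in> carrier I \<rightarrow> carrier P"

definition net_up :: "'p gorder \<Rightarrow> 'i gorder \<Rightarrow> ('i \<Rightarrow> 'p) \<Rightarrow> 'p \<Rightarrow> bool" where
  "net_up P I x l \<longleftrightarrow> net_in P I x \<and>
     (\<forall>a\<in>carrier I. \<forall>b\<in>carrier I. b \<sqsubseteq>\<^bsub>I\<^esub> a \<longrightarrow> x b \<sqsubseteq>\<^bsub>P\<^esub> x a) \<and> is_sup P (x ` carrier I) l"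

definition net_down :: "'p gorder \<Rightarrow> 'i gorder \<Rightarrow> ('i \<Rightarrow> 'p) \<Rightarrow> 'p \<Rightarrow> bool" where
  "net_down P I x l \<longleftrightarrow> net_in P I x \<and>
     (\<forall>a\<in>carrier I. \<forall>b\<in>carrier I. b \<sqsubseteq>\<^bsub>I\<^esub> a \<longrightarrow> x a \<sqsubseteq>\<^bsub>P\<^esub> x b) \<and> is_inf P (x ` carrier I) l"

definition o1_conv :: "'p gorder \<Rightarrow> 'i gorder \<Rightarrow> ('i \<Rightarrow> 'p) \<Rightarrow> 'p \<Rightarrow> bool" where
  "o1_conv P A x l \<longleftrightarrow> net_in P A x \<and>
     (\<exists>h c. net_up P A h l \<and> net_down P A c l \<and>
        (\<forall>a\<in>carrier A. h a \<sqsubseteq>\<^bsub>P\<^esub> x a \<and> x a \<sqsubseteq>\<^bsub>P\<^esub> c a))"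

definition o2_conv :: "'p gorder \<Rightarrow> 'i gorder \<Rightarrow> ('i \<Rightarrow> 'p) \<Rightarrow> 'p \<Rightarrow> bool" where
  "o2_conv P A x l \<longleftrightarrow> net_in P A x \<and>
     (\<exists>h c. \<exists>a0\<in>carrier A. net_up P A h l \<and> net_down P A c l \<and>
        (\<forall>a\<in>carrier A. a0 \<sqsubseteq>\<^bsub>A\<^esub> a \<longrightarrow> h a \<sqsubseteq>\<^bsub>P\<^esub> x a \<and> x a \<sqsubseteq>\<^bsub>P\<^esub> c a))"

definition o3_conv :: "'p gorder \<Rightarrow> 'i gorder \<Rightarrow> ('i \<Rightarrow> 'p) \<Rightarrow> 'p \<Rightarrow> bool" where
  "o3_conv P A x l \<longleftrightarrow> net_in P A x \<and>
     (\<exists>(B::'i gorder) (C::'i gorder) h c \<eta>.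
        net_up P B h l \<and> net_down P C c l \<and> \<eta> \<in> carrier B \<times> carrier C \<rightarrow> carrier A \<and>
        (\<forall>b\<in>carrier B. \<forall>g\<in>carrier C. \<forall>a\<in>carrier A.
           \<eta> (b, g) \<sqsubseteq>\<^bsub>A\<^esub> a \<longrightarrow> h b \<sqsubseteq>\<^bsub>P\<^esub> x a \<and> x a \<sqsubseteq>\<^bsub>P\<^esub> c g))"

definition o1_continuous :: "'i itself \<Rightarrow> 'p gorder \<Rightarrow> 'q gorder \<Rightarrow> ('p \<Rightarrow> 'q) \<Rightarrow> bool" where
  "o1_continuous _ P Q f \<longleftrightarrow>
     (\<forall>(A::'i gorder) x l. o1_conv P A x l \<longrightarrow> o1_conv Q A (\<lambda>a. f (x a)) (f l))"

definition o2_continuous :: "'i itself \<Rightarrow> 'p gorder \<Rightarrow> 'q gorder \<Rightarrow> ('p \<Rightarrow> 'q) \<Rightarrow> bool" where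
  "o2_continuous _ P Q f \<longleftrightarrow>
     (\<forall>(A::'i gorder) x l. o2_conv P A x l \<longrightarrow> o2_conv Q A (\<lambda>a. f (x a)) (f l))"

definition o3_continuous :: "'i itself \<Rightarrow> 'p gorder \<Rightarrow> 'q gorder \<Rightarrow> ('p \<Rightarrow> 'q) \<Rightarrow> bool" where
  "o3_continuous _ P Q f \<longleftrightarrow>
     (\<forall>(A::'i gorder) x l. o3_conv P A x l \<longrightarrow> o3_conv Q A (\<lambda>a. f (x a)) (f l))"

section \<open>Order topology\<close>

definition net_catching :: "'i itself \<Rightarrow> 'p gorder \<Rightarrow> 'p set \<Rightarrow> 'p \<Rightarrow> bool" where
  "net_catching _ P U x \<longleftrightarrow>
     (\<forall>(A::'i gorder) h c. net_up P A h x \<and> net_down P A c x \<longrightarrow>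
        (\<exists>a\<in>carrier A. \<lbrace>h a..c a\<rbrace>\<^bsub>P\<^esub> \<subseteq> U))"

definition order_open :: "'i itself \<Rightarrow> 'p gorder \<Rightarrow> 'p set \<Rightarrow> bool" where
  "order_open i P U \<longleftrightarrow> U \<subseteq> carrier P \<and> (\<forall>x\<in>U. net_catching i P U x)"

definition order_closed :: "'i itself \<Rightarrow> 'p gorder \<Rightarrow> 'p set \<Rightarrow> bool" where
  "order_closed i P M \<longleftrightarrow> M \<subseteq> carrier P \<and> order_open i P (carrier P - M)"

definition tau_o :: "'i itself \<Rightarrow> 'p gorder \<Rightarrow> 'p topology" where
  "tau_o i P = topology (order_open i P)"

lemma index_set_nonempty: "index_set A \<Longrightarrow> \<exists>a. a \<in> carrier A"
  by (auto simp: index_set_def)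

lemma istopology_order_open:
  assumes "partial_order P"
  shows "istopology (order_open (i::'i itself) P)"
  unfolding istopology_def
proof (intro conjI allI impI)
  interpret partial_order P by fact
  fix S T assume S: "order_open i P S" and T: "order_open i P T"
  show "order_open i P (S \<inter> T)"
    unfolding order_open_def net_catching_def
  proof (intro conjI ballI allI impI)
    show "S \<inter> T \<subseteq> carrier P" using S by (auto simp: order_open_def)
  next
    fix x and A :: "'i gorder" and h c
    assume x: "x \<in> S \<inter> T" and hc: "net_up P A h x \<and> net_down P A c x"
    obtain a where a: "a \<in> carrier A" "\<lbrace>h a..c a\<rbrace>\<^bsub>P\<^esub> \<subseteq> S"
      using S x hc unfolding order_open_def net_catching_def by blast
    obtain b where b: "b \<in> carrier A" "\<lbrace>h b..c b\<rbrace>\<^bsub>P\<^esub> \<subseteq> T"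
      using T x hc unfolding order_open_def net_catching_def by blast
    obtain d where d: "d \<in> carrier A" "a \<sqsubseteq>\<^bsub>A\<^esub> d" "b \<sqsubseteq>\<^bsub>A\<^esub> d"
      using hc a(1) b(1) unfolding net_up_def net_in_def index_set_def directed_in_def by blast
    have cl: "h e \<in> carrier P" "c e \<in> carrier P" if "e \<in> carrier A" for e
      using hc that by (auto simp: net_up_def net_down_def net_in_def)
    have sub: "\<lbrace>h d..c d\<rbrace>\<^bsub>P\<^esub> \<subseteq> \<lbrace>h e..c e\<rbrace>\<^bsub>P\<^esub>" if e: "e \<in> carrier A" "e \<sqsubseteq>\<^bsub>A\<^esub> d" for e
    proof
      fix z assume z: "z \<in> \<lbrace>h d..c d\<rbrace>\<^bsub>P\<^esub>"
      have "h e \<sqsubseteq>\<^bsub>P\<^esub> h d" "c d \<sqsubseteq>\<^bsub>P\<^esub> c e"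
        using hc e d(1) by (auto simp: net_up_def net_down_def)
      with z cl[OF e(1)] cl[OF d(1)] show "z \<in> \<lbrace>h e..c e\<rbrace>\<^bsub>P\<^esub>"
        unfolding at_least_at_most_def by (blast intro: le_trans)
    qed
    show "\<exists>a\<in>carrier A. \<lbrace>h a..c a\<rbrace>\<^bsub>P\<^esub> \<subseteq> S \<inter> T"
      using sub[OF a(1) d(2)] sub[OF b(1) d(3)] a(2) b(2) d(1) by blast
  qed
next
  fix K assume K: "\<forall>S\<in>K. order_open i P S"
  show "order_open i P (\<Union>K)"
    unfolding order_open_def net_catching_def
  proof (intro conjI ballI allI impI)
    show "\<Union>K \<subseteq> carrier P" using K by (auto simp: order_open_def)
  next
    fix x and A :: "'i gorder" and h c
    assume "x \<in> \<Union>K" and hc: "net_up P A h x \<and> net_down P A c x"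
    then obtain S where "S \<in> K" "x \<in> S" by blast
    with K hc show "\<exists>a\<in>carrier A. \<lbrace>h a..c a\<rbrace>\<^bsub>P\<^esub> \<subseteq> \<Union>K"
      unfolding order_open_def net_catching_def by (meson Union_upper order_trans)
  qed
qed

lemma openin_tau_o: "partial_order P \<Longrightarrow> openin (tau_o i P) U \<longleftrightarrow> order_open i P U"
  by (simp add: tau_o_def istopology_order_open topology_inverse')

lemma topspace_tau_o:
  assumes "partial_order P"
  shows "topspace (tau_o (i::'i itself) P) = carrier P"
proof -
  have "order_open i P (carrier P)"
    unfolding order_open_def net_catching_def
    by (auto simp: at_least_at_most_def net_up_def net_in_def dest: index_set_nonempty)
  then show ?thesis
    using assms by (auto simp: topspace_def openin_tau_o order_open_def)
qed

lemma closedin_tau_o: "partial_order P \<Longrightarrow> closedin (tau_o i P) M \<longleftrightarrow> order_closed i P M"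
  by (simp add: closedin_def topspace_tau_o openin_tau_o order_closed_def)

lemma partial_order_type_poset: "partial_order type_poset"
  by unfold_locales (auto simp: type_poset_def)

definition order_continuous :: "'i itself \<Rightarrow> 'p gorder \<Rightarrow> 'q gorder \<Rightarrow> ('p \<Rightarrow> 'q) \<Rightarrow> bool" where
  "order_continuous i P Q f \<longleftrightarrow> continuous_map (tau_o i P) (tau_o i Q) f"

text \<open>
  The order topology does not depend on the universe \<^typ>\<open>'i\<close> once pairs of points of the
  partially ordered set can be encoded in it: a pair of nets can be re-indexed by its range.
\<close>

lemma net_catching_universe:
  fixes P :: "'p gorder" and e :: "'p \<times> 'p \<Rightarrow> 'i"
  assumes P: "partial_order P" and e: "inj e" and nc: "net_catching TYPE('i) P U x"
  shows "net_catching TYPE('j) P U x"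
  unfolding net_catching_def
proof (intro allI impI)
  interpret P: partial_order P by fact
  fix A :: "'j gorder" and h c
  assume "net_up P A h x \<and> net_down P A c x"
  then have up: "net_up P A h x" and down: "net_down P A c x" by auto
  have cl: "h a \<in> carrier P" "c a \<in> carrier P" if "a \<in> carrier A" for a
    using up down that by (auto simp: net_up_def net_down_def net_in_def)
  define k where "k a = e (h a, c a)" for a
  define h' where "h' = (\<lambda>t. fst (inv e t))"
  define c' where "c' = (\<lambda>t. snd (inv e t))"
  define J :: "'i gorder" where "J = \<lparr>carrier = k ` carrier A, eq = (=),
    le = (\<lambda>s t. h' s \<sqsubseteq>\<^bsub>P\<^esub> h' t \<and> c' t \<sqsubseteq>\<^bsub>P\<^esub> c' s)\<rparr>"
  have [simp]: "h' (k a) = h a" "c' (k a) = c a" for a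
    using e by (simp_all add: h'_def c'_def k_def)
  have k_eq: "k a = k b" if "h a = h b" "c a = c b" for a b using that by (simp add: k_def)
  have poJ: "partial_order J"
  proof unfold_locales
    fix s t assume "s \<sqsubseteq>\<^bsub>J\<^esub> t" "t \<sqsubseteq>\<^bsub>J\<^esub> s" "s \<in> carrier J" "t \<in> carrier J"
    then show "s .=\<^bsub>J\<^esub> t" by (auto simp: J_def intro!: k_eq P.le_antisym cl)
  next
    fix s t r assume "s \<sqsubseteq>\<^bsub>J\<^esub> t" "t \<sqsubseteq>\<^bsub>J\<^esub> r" "s \<in> carrier J" "t \<in> carrier J" "r \<in> carrier J"
    then show "s \<sqsubseteq>\<^bsub>J\<^esub> r" by (auto simp: J_def) (meson P.le_trans cl)+
  qed (auto simp: J_def cl)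
  have iA: "index_set A" using up by (simp add: net_up_def net_in_def)
  have dirJ: "directed_in J (carrier J)"
    unfolding directed_in_def
  proof (intro ballI)
    fix s t assume "s \<in> carrier J" "t \<in> carrier J"
    then obtain a b where ab: "a \<in> carrier A" "b \<in> carrier A" and st: "s = k a" "t = k b"
      by (auto simp: J_def)
    obtain d where d: "d \<in> carrier A" "a \<sqsubseteq>\<^bsub>A\<^esub> d" "b \<sqsubseteq>\<^bsub>A\<^esub> d"
      using iA ab unfolding index_set_def directed_in_def by blast
    have "k d \<in> carrier J" "s \<sqsubseteq>\<^bsub>J\<^esub> k d" "t \<sqsubseteq>\<^bsub>J\<^esub> k d"
      using up down ab d by (auto simp: J_def st net_up_def net_down_def)
    then show "\<exists>z\<in>carrier J. s \<sqsubseteq>\<^bsub>J\<^esub> z \<and> t \<sqsubseteq>\<^bsub>J\<^esub> z" by blast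
  qed
  have iJ: "index_set J"
    using poJ dirJ iA by (auto simp: index_set_def J_def)
  have im: "h' ` carrier J = h ` carrier A" "c' ` carrier J = c ` carrier A"
    by (auto simp: J_def image_iff)
  have "net_up P J h' x" "net_down P J c' x"
    using iJ up down cl unfolding net_up_def net_down_def net_in_def im
    by (auto simp: J_def)
  then obtain t where "t \<in> carrier J" "\<lbrace>h' t..c' t\<rbrace>\<^bsub>P\<^esub> \<subseteq> U"
    using nc unfolding net_catching_def by blast
  moreover from this obtain a where "a \<in> carrier A" "t = k a" by (auto simp: J_def)
  ultimately have "\<lbrace>h a..c a\<rbrace>\<^bsub>P\<^esub> \<subseteq> U" by simp
  with \<open>a \<in> carrier A\<close> show "\<exists>a\<in>carrier A. \<lbrace>h a..c a\<rbrace>\<^bsub>P\<^esub> \<subseteq> U" by blast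
qed

text \<open>
  Likewise, restricting the auxiliary index sets in \<^const>\<open>o3_conv\<close> to the universe of the net
  itself loses nothing once the points of the partially ordered set can be encoded in it.
\<close>

lemma net_up_range:
  fixes P :: "'p gorder" and e :: "'p \<Rightarrow> 'i" and B :: "'b gorder"
  assumes P: "partial_order P" and e: "inj e" and net: "net_up P B h l"
  shows "\<exists>(J::'i gorder) s. net_up P J (inv e) l \<and> s \<in> carrier J \<rightarrow> carrier B \<and>
           (\<forall>t\<in>carrier J. inv e t = h (s t))"
proof -
  interpret P: partial_order P by fact
  have cl: "h b \<in> carrier P" if "b \<in> carrier B" for b
    using net that by (auto simp: net_up_def net_in_def)
  have iB: "index_set B" using net by (simp add: net_up_def net_in_def)
  have [simp]: "inv e (e p) = p" for p using e by simp
  define J :: "'i gorder" where "J = \<lparr>carrier = (\<lambda>b. e (h b)) ` carrier B, eq = (=),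
    le = (\<lambda>s t. inv e s \<sqsubseteq>\<^bsub>P\<^esub> inv e t)\<rparr>"
  have poJ: "partial_order J"
  proof unfold_locales
    fix s t assume "s \<sqsubseteq>\<^bsub>J\<^esub> t" "t \<sqsubseteq>\<^bsub>J\<^esub> s" "s \<in> carrier J" "t \<in> carrier J"
    then show "s .=\<^bsub>J\<^esub> t" by (auto simp: J_def intro!: arg_cong[where f = e] P.le_antisym cl)
  next
    fix s t r assume "s \<sqsubseteq>\<^bsub>J\<^esub> t" "t \<sqsubseteq>\<^bsub>J\<^esub> r" "s \<in> carrier J" "t \<in> carrier J" "r \<in> carrier J"
    then show "s \<sqsubseteq>\<^bsub>J\<^esub> r" by (auto simp: J_def) (meson P.le_trans cl)
  qed (auto simp: J_def cl)
  have dirJ: "directed_in J (carrier J)"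
    unfolding directed_in_def
  proof (intro ballI)
    fix s t assume "s \<in> carrier J" "t \<in> carrier J"
    then obtain a b where ab: "a \<in> carrier B" "b \<in> carrier B" and st: "s = e (h a)" "t = e (h b)"
      by (auto simp: J_def)
    obtain d where d: "d \<in> carrier B" "a \<sqsubseteq>\<^bsub>B\<^esub> d" "b \<sqsubseteq>\<^bsub>B\<^esub> d"
      using iB ab unfolding index_set_def directed_in_def by blast
    have "e (h d) \<in> carrier J" "s \<sqsubseteq>\<^bsub>J\<^esub> e (h d)" "t \<sqsubseteq>\<^bsub>J\<^esub> e (h d)"
      using net ab d by (auto simp: J_def st net_up_def)
    then show "\<exists>z\<in>carrier J. s \<sqsubseteq>\<^bsub>J\<^esub> z \<and> t \<sqsubseteq>\<^bsub>J\<^esub> z" by blast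
  qed
  have iJ: "index_set J"
    using poJ dirJ iB by (auto simp: index_set_def J_def)
  have im: "inv e ` carrier J = h ` carrier B"
    by (auto simp: J_def image_iff)
  have "net_up P J (inv e) l"
    using iJ net cl unfolding net_up_def net_in_def im by (auto simp: J_def)
  moreover have "\<forall>t\<in>carrier J. \<exists>b\<in>carrier B. inv e t = h b"
    by (auto simp: J_def)
  then obtain s where "\<forall>t\<in>carrier J. s t \<in> carrier B \<and> inv e t = h (s t)" by metis
  ultimately show ?thesis by blast
qed

lemma net_down_range:
  fixes P :: "'p gorder" and e :: "'p \<Rightarrow> 'i" and B :: "'b gorder"
  assumes P: "partial_order P" and e: "inj e" and net: "net_down P B h l"
  shows "\<exists>(J::'i gorder) s. net_down P J (inv e) l \<and> s \<in> carrier J \<rightarrow> carrier B \<and>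
           (\<forall>t\<in>carrier J. inv e t = h (s t))"
proof -
  interpret P: partial_order P by fact
  have cl: "h b \<in> carrier P" if "b \<in> carrier B" for b
    using net that by (auto simp: net_down_def net_in_def)
  have iB: "index_set B" using net by (simp add: net_down_def net_in_def)
  have [simp]: "inv e (e p) = p" for p using e by simp
  define J :: "'i gorder" where "J = \<lparr>carrier = (\<lambda>b. e (h b)) ` carrier B, eq = (=),
    le = (\<lambda>s t. inv e t \<sqsubseteq>\<^bsub>P\<^esub> inv e s)\<rparr>"
  have poJ: "partial_order J"
  proof unfold_locales
    fix s t assume "s \<sqsubseteq>\<^bsub>J\<^esub> t" "t \<sqsubseteq>\<^bsub>J\<^esub> s" "s \<in> carrier J" "t \<in> carrier J"
    then show "s .=\<^bsub>J\<^esub> t" by (auto simp: J_def intro!: arg_cong[where f = e] P.le_antisym cl)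
  next
    fix s t r assume "s \<sqsubseteq>\<^bsub>J\<^esub> t" "t \<sqsubseteq>\<^bsub>J\<^esub> r" "s \<in> carrier J" "t \<in> carrier J" "r \<in> carrier J"
    then show "s \<sqsubseteq>\<^bsub>J\<^esub> r" by (auto simp: J_def) (meson P.le_trans cl)
  qed (auto simp: J_def cl)
  have dirJ: "directed_in J (carrier J)"
    unfolding directed_in_def
  proof (intro ballI)
    fix s t assume "s \<in> carrier J" "t \<in> carrier J"
    then obtain a b where ab: "a \<in> carrier B" "b \<in> carrier B" and st: "s = e (h a)" "t = e (h b)"
      by (auto simp: J_def)
    obtain d where d: "d \<in> carrier B" "a \<sqsubseteq>\<^bsub>B\<^esub> d" "b \<sqsubseteq>\<^bsub>B\<^esub> d"
      using iB ab unfolding index_set_def directed_in_def by blast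
    have "e (h d) \<in> carrier J" "s \<sqsubseteq>\<^bsub>J\<^esub> e (h d)" "t \<sqsubseteq>\<^bsub>J\<^esub> e (h d)"
      using net ab d by (auto simp: J_def st net_down_def)
    then show "\<exists>z\<in>carrier J. s \<sqsubseteq>\<^bsub>J\<^esub> z \<and> t \<sqsubseteq>\<^bsub>J\<^esub> z" by blast
  qed
  have iJ: "index_set J"
    using poJ dirJ iB by (auto simp: index_set_def J_def)
  have im: "inv e ` carrier J = h ` carrier B"
    by (auto simp: J_def image_iff)
  have "net_down P J (inv e) l"
    using iJ net cl unfolding net_down_def net_in_def im by (auto simp: J_def)
  moreover have "\<forall>t\<in>carrier J. \<exists>b\<in>carrier B. inv e t = h b"
    by (auto simp: J_def)
  then obtain s where "\<forall>t\<in>carrier J. s t \<in> carrier B \<and> inv e t = h (s t)" by metis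
  ultimately show ?thesis by blast
qed

lemma o3_conv_universe:
  fixes P :: "'p gorder" and e :: "'p \<Rightarrow> 'i" and A :: "'i gorder"
    and B :: "'b gorder" and C :: "'c gorder"
  assumes P: "partial_order P" and e: "inj e" and x: "net_in P A x"
    and h: "net_up P B h l" and c: "net_down P C c l"
    and eta: "\<eta> \<in> carrier B \<times> carrier C \<rightarrow> carrier A"
    and bnd: "\<And>b g a. \<lbrakk>b \<in> carrier B; g \<in> carrier C; a \<in> carrier A; \<eta> (b, g) \<sqsubseteq>\<^bsub>A\<^esub> a\<rbrakk>
                \<Longrightarrow> h b \<sqsubseteq>\<^bsub>P\<^esub> x a \<and> x a \<sqsubseteq>\<^bsub>P\<^esub> c g"
  shows "o3_conv P A x l"
proof -
  obtain J :: "'i gorder" and s where J: "net_up P J (inv e) l" "s \<in> carrier J \<rightarrow> carrier B"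
    "\<forall>t\<in>carrier J. inv e t = h (s t)"
    using net_up_range[OF P e h] by blast
  obtain K :: "'i gorder" and r where K: "net_down P K (inv e) l" "r \<in> carrier K \<rightarrow> carrier C"
    "\<forall>t\<in>carrier K. inv e t = c (r t)"
    using net_down_range[OF P e c] by blast
  define \<eta>' where "\<eta>' = (\<lambda>(t, u). \<eta> (s t, r u))"
  have eta': "\<eta>' \<in> carrier J \<times> carrier K \<rightarrow> carrier A"
    using eta J(2) K(2) by (auto simp: \<eta>'_def Pi_iff)
  have "\<forall>t\<in>carrier J. \<forall>u\<in>carrier K. \<forall>a\<in>carrier A.
      \<eta>' (t, u) \<sqsubseteq>\<^bsub>A\<^esub> a \<longrightarrow> inv e t \<sqsubseteq>\<^bsub>P\<^esub> x a \<and> x a \<sqsubseteq>\<^bsub>P\<^esub> inv e u"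
  proof (intro ballI impI)
    fix t u a
    assume *: "t \<in> carrier J" "u \<in> carrier K" "a \<in> carrier A" "\<eta>' (t, u) \<sqsubseteq>\<^bsub>A\<^esub> a"
    have "s t \<in> carrier B" "r u \<in> carrier C" using * J(2) K(2) by (auto simp: Pi_iff)
    then show "inv e t \<sqsubseteq>\<^bsub>P\<^esub> x a \<and> x a \<sqsubseteq>\<^bsub>P\<^esub> inv e u"
      using bnd[of "s t" "r u" a] * J(3) K(3) by (simp add: \<eta>'_def)
  qed
  with J(1) K(1) eta' x show ?thesis unfolding o3_conv_def by blast
qed

section \<open>Operators between partially ordered vector spaces\<close>

text \<open>
  Partially ordered vector spaces are the types of class \<^class>\<open>ordered_real_vector\<close>; Dedekind
  complete vector lattices are those that are moreover of class
  \<^class>\<open>conditionally_complete_lattice\<close>.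
\<close>

definition riesz_decomposition_property :: "'x::ordered_real_vector itself \<Rightarrow> bool" where
  "riesz_decomposition_property _ \<longleftrightarrow>
     (\<forall>x y w :: 'x. 0 \<le> x \<and> 0 \<le> y \<and> w \<in> {0..x + y} \<longrightarrow>
        (\<exists>u\<in>{0..x}. \<exists>v\<in>{0..y}. w = u + v))"

definition order_bounded :: "'a::order set \<Rightarrow> bool" where
  "order_bounded M \<longleftrightarrow> (\<exists>a b. M \<subseteq> {a..b})"

definition order_bounded_map :: "('a::order \<Rightarrow> 'b::order) \<Rightarrow> bool" where
  "order_bounded_map f \<longleftrightarrow> (\<forall>M. order_bounded M \<longrightarrow> order_bounded (f ` M))"

definition Lb_set :: "('x::ordered_real_vector \<Rightarrow> 'y::ordered_real_vector) set" where
  "Lb_set = {T. linear T \<and> order_bounded_map T}"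

definition Lb :: "('x::ordered_real_vector \<Rightarrow> 'y::ordered_real_vector) gorder" where
  "Lb = \<lparr>carrier = Lb_set, eq = (=), le = (\<lambda>S T. \<forall>x\<ge>0. S x \<le> T x)\<rparr>"

definition Lb_o1 ::
  "'i itself \<Rightarrow> ('x::ordered_real_vector \<Rightarrow> 'y::ordered_real_vector) set" where
  "Lb_o1 i = {T \<in> Lb_set. o1_continuous i type_poset type_poset T}"

definition Lb_o2 ::
  "'i itself \<Rightarrow> ('x::ordered_real_vector \<Rightarrow> 'y::ordered_real_vector) set" where
  "Lb_o2 i = {T \<in> Lb_set. o2_continuous i type_poset type_poset T}"

definition Lb_o3 ::
  "'i itself \<Rightarrow> ('x::ordered_real_vector \<Rightarrow> 'y::ordered_real_vector) set" where
  "Lb_o3 i = {T \<in> Lb_set. o3_continuous i type_poset type_poset T}"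

definition Lb_tau ::
  "'i itself \<Rightarrow> ('x::ordered_real_vector \<Rightarrow> 'y::ordered_real_vector) set" where
  "Lb_tau i = {T \<in> Lb_set. order_continuous i type_poset type_poset T}"

definition Lpos_oc ::
  "'i itself \<Rightarrow> ('x::ordered_real_vector \<Rightarrow> 'y::ordered_real_vector) set" where
  "Lpos_oc i = {T. linear T \<and> mono T \<and> order_continuous i type_poset type_poset T}"

text \<open>The binary operator \<open>-\<close> on sets is the set-theoretic difference, hence a separate notion.\<close>

definition difference_set :: "'a::minus set \<Rightarrow> 'a set \<Rightarrow> 'a set" where
  "difference_set M N = {m - n |m n. m \<in> M \<and> n \<in> N}"

definition additive_subgroup_in :: "'a::ab_group_add set \<Rightarrow> 'a set \<Rightarrow> bool" where
  "additive_subgroup_in G M \<longleftrightarrow>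
     M \<subseteq> G \<and> 0 \<in> M \<and> (\<forall>x\<in>M. \<forall>y\<in>M. x + y \<in> M) \<and> (\<forall>x\<in>M. - x \<in> M)"

definition order_ideal :: "'a::ab_group_add gorder \<Rightarrow> 'a set \<Rightarrow> bool" where
  "order_ideal G M \<longleftrightarrow>
     additive_subgroup_in (carrier G) M \<and> directed_in G M \<and> full_in G M"

end

theory Submission
  imports Defs
begin

text \<open>
  All the continuity notions are compared with one index-free property of an operator \<open>T\<close>: along a
  downward directed set \<open>D\<close> with infimum \<open>0\<close>, no choice of points \<open>w x \<in> [0, x]\<close>, \<open>x \<in> D\<close>, keeps
  \<open>T (w x)\<close> above an element that is not \<open>\<le> 0\<close>, or below one that is not \<open>\<ge> 0\<close>. Each continuity
  notion implies it, because the points \<open>w x\<close> form a net that \<open>o\<^sub>1\<close>-converges to \<open>0\<close>. Conversely, the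
  property passes from \<open>T\<close> to its positive part, given by the Riesz-Kantorovich formula: by Riesz
  decomposition any \<open>u \<in> [0, x\<^sub>0]\<close> splits as \<open>v + w\<close> with \<open>v \<in> [0, x\<^sub>0 - x]\<close> and \<open>w \<in> [0, x]\<close>, so
  \<open>T w \<ge> T u - T\<^sup>+ x\<^sub>0 + T\<^sup>+ x\<close>. Hence \<open>T\<close> is a difference of two monotone operators with the
  property, and such differences are continuous in every sense. Order closedness holds since
  decreasing nets of operators have pointwise infima on the positive cone.
\<close>

section \<open>Nets in ordered types\<close>

lemma le_type_poset [simp]: "x \<sqsubseteq>\<^bsub>type_poset\<^esub> y \<longleftrightarrow> x \<le> y"
  by (simp add: type_poset_def)

lemma carrier_type_poset [simp]: "carrier type_poset = UNIV"
  by (simp add: type_poset_def)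

lemma at_least_at_most_type_poset [simp]: "\<lbrace>a..b\<rbrace>\<^bsub>type_poset\<^esub> = {a..b}"
  by (auto simp: at_least_at_most_def)

lemma is_sup_type_poset:
  "is_sup type_poset S l \<longleftrightarrow> (\<forall>s\<in>S. s \<le> l) \<and> (\<forall>u. (\<forall>s\<in>S. s \<le> u) \<longrightarrow> l \<le> u)"
  unfolding is_sup_def least_def Upper_def by (auto simp: Ball_def)

lemma is_inf_type_poset:
  "is_inf type_poset S l \<longleftrightarrow> (\<forall>s\<in>S. l \<le> s) \<and> (\<forall>u. (\<forall>s\<in>S. u \<le> s) \<longrightarrow> u \<le> l)"
  unfolding is_inf_def greatest_def Lower_def by (auto simp: Ball_def)

lemma net_in_type_poset [simp]: "net_in type_poset A x \<longleftrightarrow> index_set A"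
  by (simp add: net_in_def)

lemma net_up_type_poset:
  "net_up type_poset A h l \<longleftrightarrow> index_set A \<and>
     (\<forall>a\<in>carrier A. \<forall>b\<in>carrier A. b \<sqsubseteq>\<^bsub>A\<^esub> a \<longrightarrow> h b \<le> h a) \<and>
     (\<forall>a\<in>carrier A. h a \<le> l) \<and> (\<forall>u. (\<forall>a\<in>carrier A. h a \<le> u) \<longrightarrow> l \<le> u)"
  unfolding net_up_def is_sup_type_poset by auto

lemma net_down_type_poset:
  "net_down type_poset A c l \<longleftrightarrow> index_set A \<and>
     (\<forall>a\<in>carrier A. \<forall>b\<in>carrier A. b \<sqsubseteq>\<^bsub>A\<^esub> a \<longrightarrow> c a \<le> c b) \<and>
     (\<forall>a\<in>carrier A. l \<le> c a) \<and> (\<forall>u. (\<forall>a\<in>carrier A. u \<le> c a) \<longrightarrow> u \<le> l)"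
  unfolding net_down_def is_inf_type_poset by auto

lemma index_set_upper:
  assumes "index_set A" "a \<in> carrier A" "b \<in> carrier A"
  obtains d where "d \<in> carrier A" "a \<sqsubseteq>\<^bsub>A\<^esub> d" "b \<sqsubseteq>\<^bsub>A\<^esub> d"
  using assms unfolding index_set_def directed_in_def by blast

lemma index_set_trans:
  assumes "index_set A" "a \<sqsubseteq>\<^bsub>A\<^esub> b" "b \<sqsubseteq>\<^bsub>A\<^esub> c"
    "a \<in> carrier A" "b \<in> carrier A" "c \<in> carrier A"
  shows "a \<sqsubseteq>\<^bsub>A\<^esub> c"
proof -
  interpret partial_order A using assms(1) by (simp add: index_set_def)
  show ?thesis using assms le_trans by blast
qed

section \<open>Comparison of the three modes of order convergence\<close>

lemma o1_conv_imp_o2_conv: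
  assumes "o1_conv P A x l"
  shows "o2_conv P A x l"
proof -
  obtain a0 where "a0 \<in> carrier A"
    using assms unfolding o1_conv_def net_in_def index_set_def by blast
  with assms show ?thesis unfolding o1_conv_def o2_conv_def by blast
qed

text \<open>The bounding nets are kept, with both auxiliary index sets equal to \<open>A\<close>.
  The map \<eta> sends \<open>(b, g)\<close> to a common upper bound of \<open>b\<close>,
  \<open>g\<close> and \<open>a0\<close>; beyond it, monotonicity gives
  \<open>h b \<le> h a \<le> x a \<le> c a \<le> c g\<close>.\<close>

lemma o2_conv_imp_o3_conv:
  fixes x :: "'i \<Rightarrow> 'p::order" and A :: "'i gorder"
  assumes "o2_conv type_poset A x l"
  shows "o3_conv type_poset A x l"
proof -
  obtain h c a0 where a0: "a0 \<in> carrier A"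
    and up: "net_up type_poset A h l" and down: "net_down type_poset A c l"
    and bnd: "\<And>a. a \<in> carrier A \<Longrightarrow> a0 \<sqsubseteq>\<^bsub>A\<^esub> a \<Longrightarrow> h a \<le> x a \<and> x a \<le> c a"
    using assms unfolding o2_conv_def by auto
  have A: "index_set A" using up by (simp add: net_up_type_poset)
  have "\<exists>d\<in>carrier A. b \<sqsubseteq>\<^bsub>A\<^esub> d \<and> g \<sqsubseteq>\<^bsub>A\<^esub> d \<and> a0 \<sqsubseteq>\<^bsub>A\<^esub> d"
    if bg: "b \<in> carrier A" "g \<in> carrier A" for b g
  proof -
    obtain d where d: "d \<in> carrier A" "b \<sqsubseteq>\<^bsub>A\<^esub> d" "g \<sqsubseteq>\<^bsub>A\<^esub> d"
      using index_set_upper[OF A bg] .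
    obtain f where f: "f \<in> carrier A" "d \<sqsubseteq>\<^bsub>A\<^esub> f" "a0 \<sqsubseteq>\<^bsub>A\<^esub> f"
      using index_set_upper[OF A d(1) a0] .
    have "b \<sqsubseteq>\<^bsub>A\<^esub> f" "g \<sqsubseteq>\<^bsub>A\<^esub> f"
      using index_set_trans[OF A _ f(2) _ d(1) f(1)] d bg by auto
    with f show ?thesis by blast
  qed
  then obtain e where e: "\<And>b g. b \<in> carrier A \<Longrightarrow> g \<in> carrier A \<Longrightarrow>
      e b g \<in> carrier A \<and> b \<sqsubseteq>\<^bsub>A\<^esub> e b g \<and> g \<sqsubseteq>\<^bsub>A\<^esub> e b g \<and> a0 \<sqsubseteq>\<^bsub>A\<^esub> e b g"
    by metis
  have "h b \<le> x a \<and> x a \<le> c g"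
    if *: "b \<in> carrier A" "g \<in> carrier A" "a \<in> carrier A" "e b g \<sqsubseteq>\<^bsub>A\<^esub> a" for a b g
  proof -
    have "b \<sqsubseteq>\<^bsub>A\<^esub> a" "g \<sqsubseteq>\<^bsub>A\<^esub> a" "a0 \<sqsubseteq>\<^bsub>A\<^esub> a"
      using index_set_trans[OF A _ *(4) _ _ *(3)] e[OF *(1,2)] * a0 by auto
    then have "h b \<le> h a" "c a \<le> c g" "h a \<le> x a" "x a \<le> c a"
      using up down bnd * by (auto simp: net_up_type_poset net_down_type_poset)
    then show ?thesis by auto
  qed
  then have "\<forall>b\<in>carrier A. \<forall>g\<in>carrier A. \<forall>a\<in>carrier A.
      case_prod e (b, g) \<sqsubseteq>\<^bsub>A\<^esub> a \<longrightarrow> h b \<sqsubseteq>\<^bsub>type_poset\<^esub> x a \<and> x a \<sqsubseteq>\<^bsub>type_poset\<^esub> c g"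
    by simp
  moreover have "case_prod e \<in> carrier A \<times> carrier A \<rightarrow> carrier A" using e by auto
  ultimately show ?thesis
    using up down A unfolding o3_conv_def net_in_type_poset by blast
qed

section \<open>Products of index sets\<close>

definition prod_index :: "'a gorder \<Rightarrow> 'b gorder \<Rightarrow> ('a \<times> 'b) gorder" where
  "prod_index A B = \<lparr>carrier = carrier A \<times> carrier B, eq = (=),
     le = (\<lambda>p q. fst p \<sqsubseteq>\<^bsub>A\<^esub> fst q \<and> snd p \<sqsubseteq>\<^bsub>B\<^esub> snd q)\<rparr>"

lemma index_set_prod_index:
  assumes A: "index_set A" and B: "index_set B"
  shows "index_set (prod_index A B)"
proof -
  interpret A: partial_order A using A by (simp add: index_set_def)
  interpret B: partial_order B using B by (simp add: index_set_def)
  have "partial_order (prod_index A B)"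
  proof unfold_locales
    fix p q assume "p \<sqsubseteq>\<^bsub>prod_index A B\<^esub> q" "q \<sqsubseteq>\<^bsub>prod_index A B\<^esub> p"
      "p \<in> carrier (prod_index A B)" "q \<in> carrier (prod_index A B)"
    then show "p .=\<^bsub>prod_index A B\<^esub> q"
      by (auto simp: prod_index_def intro: A.le_antisym B.le_antisym)
  next
    fix p q r assume "p \<sqsubseteq>\<^bsub>prod_index A B\<^esub> q" "q \<sqsubseteq>\<^bsub>prod_index A B\<^esub> r"
      "p \<in> carrier (prod_index A B)" "q \<in> carrier (prod_index A B)" "r \<in> carrier (prod_index A B)"
    then show "p \<sqsubseteq>\<^bsub>prod_index A B\<^esub> r"
      unfolding prod_index_def by (auto dest: A.le_trans B.le_trans)
  qed (auto simp: prod_index_def)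
  moreover have "directed_in (prod_index A B) (carrier (prod_index A B))"
    unfolding directed_in_def
  proof (intro ballI)
    fix p q assume pq: "p \<in> carrier (prod_index A B)" "q \<in> carrier (prod_index A B)"
    then have "fst p \<in> carrier A" "fst q \<in> carrier A" "snd p \<in> carrier B" "snd q \<in> carrier B"
      by (auto simp: prod_index_def)
    then obtain a b where "a \<in> carrier A" "fst p \<sqsubseteq>\<^bsub>A\<^esub> a" "fst q \<sqsubseteq>\<^bsub>A\<^esub> a"
      "b \<in> carrier B" "snd p \<sqsubseteq>\<^bsub>B\<^esub> b" "snd q \<sqsubseteq>\<^bsub>B\<^esub> b"
      using A B unfolding index_set_def directed_in_def by blast
    then show "\<exists>r\<in>carrier (prod_index A B). p \<sqsubseteq>\<^bsub>prod_index A B\<^esub> r \<and> q \<sqsubseteq>\<^bsub>prod_index A B\<^esub> r"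
      by (intro bexI[of _ "(a, b)"]) (auto simp: prod_index_def)
  qed
  moreover have "carrier (prod_index A B) \<noteq> {}"
    using A B by (simp add: index_set_def prod_index_def)
  ultimately show ?thesis by (simp add: index_set_def)
qed

text \<open>The other factor is nonempty, so the range of the net, and with it the supremum, is
  unchanged. This puts the two bounding nets of an o3-convergent net over one index set.\<close>

lemma net_up_prod_index:
  assumes "net_up type_poset A h l" "index_set B"
  shows "net_up type_poset (prod_index A B) (\<lambda>p. h (fst p)) l"
  using assms index_set_nonempty[OF assms(2)] index_set_prod_index[of A B]
  unfolding net_up_type_poset by (auto simp: prod_index_def)

lemma net_down_prod_index:
  assumes "net_down type_poset B c l" "index_set A"
  shows "net_down type_poset (prod_index A B) (\<lambda>p. c (snd p)) l"
  using assms index_set_nonempty[OF assms(2)] index_set_prod_index[of A B]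
  unfolding net_down_type_poset by (auto simp: prod_index_def)

section \<open>Vanishing operators\<close>

text \<open>What remains of a net decreasing to \<open>0\<close> when only its range is kept; it
  makes the later arguments independent of the universe \<open>'i\<close>.\<close>

definition down_null :: "'a::{order, zero} set \<Rightarrow> bool" where
  "down_null D \<longleftrightarrow> D \<noteq> {} \<and> (\<forall>x\<in>D. \<forall>y\<in>D. \<exists>z\<in>D. z \<le> x \<and> z \<le> y) \<and>
     (\<forall>x\<in>D. 0 \<le> x) \<and> (\<forall>l. (\<forall>x\<in>D. l \<le> x) \<longrightarrow> l \<le> 0)"

text \<open>Phrased by one-sided bounds instead of infima and suprema, since the selected points
  \<open>w x\<close> need not depend monotonically on \<open>x\<close>.\<close>

definition vanishing :: "('a::{order, zero} \<Rightarrow> 'b::{order, zero}) \<Rightarrow> bool" where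
  "vanishing T \<longleftrightarrow> (\<forall>D w z. down_null D \<and> (\<forall>x\<in>D. w x \<in> {0..x}) \<longrightarrow>
     ((\<forall>x\<in>D. z \<le> T (w x)) \<longrightarrow> z \<le> 0) \<and> ((\<forall>x\<in>D. T (w x) \<le> z) \<longrightarrow> 0 \<le> z))"

text \<open>Choice produces the selector \<open>w\<close>, so a suitable point has to be found for
  each member of \<open>D\<close> separately.\<close>

lemma vanishing_le_0:
  assumes "vanishing T" "down_null D" "\<And>x. x \<in> D \<Longrightarrow> \<exists>w\<in>{0..x}. z \<le> T w"
  shows "z \<le> 0"
proof -
  obtain w where "\<forall>x\<in>D. w x \<in> {0..x} \<and> z \<le> T (w x)" using assms(3) by metis
  with assms(1,2) show ?thesis unfolding vanishing_def by blast
qed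

lemma vanishing_ge_0:
  assumes "vanishing T" "down_null D" "\<And>x. x \<in> D \<Longrightarrow> \<exists>w\<in>{0..x}. T w \<le> z"
  shows "0 \<le> z"
proof -
  obtain w where "\<forall>x\<in>D. w x \<in> {0..x} \<and> T (w x) \<le> z" using assms(3) by metis
  with assms(1,2) show ?thesis unfolding vanishing_def by blast
qed

lemma vanishingI:
  assumes "\<And>D w z. down_null D \<Longrightarrow> (\<And>x. x \<in> D \<Longrightarrow> w x \<in> {0..x}) \<Longrightarrow>
      (\<And>x. x \<in> D \<Longrightarrow> z \<le> T (w x)) \<Longrightarrow> z \<le> 0"
    and "\<And>D w z. down_null D \<Longrightarrow> (\<And>x. x \<in> D \<Longrightarrow> w x \<in> {0..x}) \<Longrightarrow>
      (\<And>x. x \<in> D \<Longrightarrow> T (w x) \<le> z) \<Longrightarrow> 0 \<le> z"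
  shows "vanishing T"
  using assms unfolding vanishing_def by blast

text \<open>Directedness makes the members below \<open>x0\<close> coinitial in \<open>D\<close>, so
  no lower bound is gained. The restriction provides a fixed \<open>x0\<close> dominating all
  selected points.\<close>

lemma down_null_below:
  assumes D: "down_null D" and x0: "x0 \<in> D"
  shows "down_null {x \<in> D. x \<le> x0}"
  unfolding down_null_def
proof (intro conjI ballI allI impI)
  show "{x \<in> D. x \<le> x0} \<noteq> {}" using x0 by blast
next
  fix x y assume "x \<in> {x \<in> D. x \<le> x0}" "y \<in> {x \<in> D. x \<le> x0}"
  moreover from this obtain z where "z \<in> D" "z \<le> x" "z \<le> y"
    using D unfolding down_null_def by blast
  ultimately show "\<exists>z\<in>{x \<in> D. x \<le> x0}. z \<le> x \<and> z \<le> y"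
    by (auto intro!: bexI[of _ z])
next
  fix x assume "x \<in> {x \<in> D. x \<le> x0}"
  with D show "0 \<le> x" by (auto simp: down_null_def)
next
  fix l assume l: "\<forall>x\<in>{x \<in> D. x \<le> x0}. l \<le> x"
  have "l \<le> x" if x: "x \<in> D" for x
  proof -
    obtain z where "z \<in> D" "z \<le> x" "z \<le> x0"
      using D x x0 unfolding down_null_def by blast
    with l show ?thesis by (blast intro: order_trans)
  qed
  with D show "l \<le> 0" by (auto simp: down_null_def)
qed

lemma vanishing_mono_le_0:
  assumes "vanishing S" "down_null D" "\<And>x. x \<in> D \<Longrightarrow> z \<le> S x"
  shows "z \<le> 0"
proof (rule vanishing_le_0[OF assms(1,2)])
  fix x assume "x \<in> D"
  with assms(2,3) show "\<exists>w\<in>{0..x}. z \<le> S w"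
    by (intro bexI[of _ x]) (auto simp: down_null_def)
qed

section \<open>Monotone linear maps and stability of vanishing\<close>

lemma linear_mono_iff:
  fixes S :: "'x::ordered_real_vector \<Rightarrow> 'y::ordered_real_vector"
  assumes "linear S"
  shows "mono S \<longleftrightarrow> (\<forall>x\<ge>0. 0 \<le> S x)"
proof
  assume "mono S"
  then show "\<forall>x\<ge>0. 0 \<le> S x"
    using linear_0[OF assms] by (metis monoD)
next
  assume pos: "\<forall>x\<ge>0. 0 \<le> S x"
  show "mono S"
  proof (rule monoI)
    fix x y :: 'x assume "x \<le> y"
    then have "0 \<le> S (y - x)" using pos by simp
    then show "S x \<le> S y" by (simp add: linear_diff[OF assms])
  qed
qed

lemma linear_nonneg:
  fixes S :: "'x::ordered_real_vector \<Rightarrow> 'y::ordered_real_vector"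
  assumes "linear S" "mono S" "0 \<le> x"
  shows "0 \<le> S x"
  using assms linear_mono_iff by blast

text \<open>By monotonicity \<open>S (w x) \<le> S x\<close>, so lower bounds only need to be tested
  at \<open>w x = x\<close>. Upper bounds take care of themselves because \<open>S (w x)\<close> is
  nonnegative.\<close>

lemma vanishing_mono_I:
  fixes S :: "'x::ordered_real_vector \<Rightarrow> 'y::ordered_real_vector"
  assumes S: "linear S" "mono S"
    and le_0: "\<And>D z. down_null D \<Longrightarrow> (\<And>x. x \<in> D \<Longrightarrow> z \<le> S x) \<Longrightarrow> z \<le> 0"
  shows "vanishing S"
proof (rule vanishingI)
  fix D w z
  assume D: "down_null D" and w: "\<And>x. x \<in> D \<Longrightarrow> w x \<in> {0..x}"
    and z: "\<And>x. x \<in> D \<Longrightarrow> z \<le> S (w x)"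
  have "z \<le> S x" if "x \<in> D" for x
    using z[OF that] w[OF that] monoD[OF S(2), of "w x" x] by auto
  with D show "z \<le> 0" by (rule le_0)
next
  fix D w z
  assume D: "down_null D" and w: "\<And>x. x \<in> D \<Longrightarrow> w x \<in> {0..x}"
    and z: "\<And>x. x \<in> D \<Longrightarrow> S (w x) \<le> z"
  obtain x where x: "x \<in> D" using D by (auto simp: down_null_def)
  with w have "0 \<le> w x" by auto
  then have "0 \<le> S (w x)" by (rule linear_nonneg[OF S(1,2)])
  with z[OF x] show "0 \<le> z" by (rule order_trans[rotated])
qed

lemma vanishing_zero: "vanishing (\<lambda>x. 0)"
  unfolding vanishing_def down_null_def by blast

lemma vanishing_uminus:
  fixes T :: "'x::ordered_real_vector \<Rightarrow> 'y::ordered_real_vector"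
  assumes "vanishing T"
  shows "vanishing (\<lambda>x. - T x)"
proof (rule vanishingI)
  fix D w z
  assume *: "down_null D" "\<And>x. x \<in> D \<Longrightarrow> w x \<in> {0..x}" "\<And>x. x \<in> D \<Longrightarrow> z \<le> - T (w x)"
  have "0 \<le> - z"
    by (rule vanishing_ge_0[OF assms *(1)]) (use *(2,3) in \<open>force simp: le_minus_iff\<close>)
  then show "z \<le> 0" by simp
next
  fix D w z
  assume *: "down_null D" "\<And>x. x \<in> D \<Longrightarrow> w x \<in> {0..x}" "\<And>x. x \<in> D \<Longrightarrow> - T (w x) \<le> z"
  have "- z \<le> 0"
    by (rule vanishing_le_0[OF assms *(1)]) (use *(2,3) in \<open>force simp: minus_le_iff\<close>)
  then show "0 \<le> z" by simp
qed

lemma vanishing_diff: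
  fixes S T :: "'x::ordered_real_vector \<Rightarrow> 'y::ordered_real_vector"
  assumes S: "linear S" "mono S" "vanishing S" and T: "vanishing T"
  shows "vanishing (\<lambda>x. S x - T x)"
proof (rule vanishingI)
  fix D w z
  assume D: "down_null D" and w: "\<And>x. x \<in> D \<Longrightarrow> w x \<in> {0..x}"
    and z: "\<And>x. x \<in> D \<Longrightarrow> z \<le> S (w x) - T (w x)"
  show "z \<le> 0"
  proof (rule vanishing_mono_le_0[OF S(3) D])
    fix x1 assume x1: "x1 \<in> D"
    have "0 \<le> S x1 - z"
    proof (rule vanishing_ge_0[OF T down_null_below[OF D x1]])
      fix x assume x: "x \<in> {x \<in> D. x \<le> x1}"
      then have "w x \<le> x1" using w[of x] by auto
      then have "S (w x) \<le> S x1" by (rule monoD[OF S(2)])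
      then have "S (w x) - z \<le> S x1 - z" by (rule diff_right_mono)
      moreover have "T (w x) \<le> S (w x) - z" using z[of x] x by (simp add: algebra_simps)
      ultimately have "T (w x) \<le> S x1 - z" by (rule order_trans[rotated])
      with w[of x] x show "\<exists>w\<in>{0..x}. T w \<le> S x1 - z" by blast
    qed
    then show "z \<le> S x1" by simp
  qed
next
  fix D w z
  assume D: "down_null D" and w: "\<And>x. x \<in> D \<Longrightarrow> w x \<in> {0..x}"
    and z: "\<And>x. x \<in> D \<Longrightarrow> S (w x) - T (w x) \<le> z"
  have "- z \<le> 0"
  proof (rule vanishing_le_0[OF T D])
    fix x assume x: "x \<in> D"
    with w have "0 \<le> w x" by auto
    then have "0 \<le> S (w x)" by (rule linear_nonneg[OF S(1,2)])
    then have "- T (w x) \<le> S (w x) - T (w x)" by simp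
    then have "- T (w x) \<le> z" using z[OF x] by (rule order_trans)
    then have "- z \<le> T (w x)" by (simp add: minus_le_iff)
    with w[OF x] show "\<exists>w\<in>{0..x}. - z \<le> T w" by blast
  qed
  then show "0 \<le> z" by simp
qed

section \<open>Continuity implies vanishing\<close>

text \<open>The set \<open>D\<close>, indexed by itself with the reversed order, is a net decreasing
  to \<open>0\<close>; \<open>net_down_range\<close> then moves its index set into
  \<open>'i\<close>.\<close>

lemma down_null_net:
  fixes e :: "'x::ordered_real_vector \<Rightarrow> 'i"
  assumes e: "inj e" and D: "down_null D"
  obtains J :: "'i gorder" where "net_down type_poset J (inv e) 0" "inv e ` carrier J \<subseteq> D"
proof -
  define B :: "'x gorder" where "B = \<lparr>carrier = D, eq = (=), le = (\<lambda>x y. y \<le> x)\<rparr>"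
  have "partial_order B" by unfold_locales (auto simp: B_def)
  with D have "index_set B"
    by (auto simp: index_set_def directed_in_def down_null_def B_def)
  with D have "net_down type_poset B id 0"
    unfolding net_down_type_poset by (auto simp: down_null_def B_def)
  from net_down_range[OF partial_order_type_poset e this]
  obtain J :: "'i gorder" and s where J: "net_down type_poset J (inv e) 0"
    "s \<in> carrier J \<rightarrow> carrier B" "\<forall>t\<in>carrier J. inv e t = id (s t)"
    by blast
  show ?thesis
    by (rule that[OF J(1)]) (use J(2,3) in \<open>auto simp: B_def\<close>)
qed

lemma net_up_const: "index_set A \<Longrightarrow> net_up type_poset A (\<lambda>_. l) l"
  unfolding net_up_type_poset using index_set_nonempty by auto

lemma o1_conv_type_posetI:
  assumes "net_up type_poset A h l" "net_down type_poset A c l"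
    "\<And>a. a \<in> carrier A \<Longrightarrow> h a \<le> x a" "\<And>a. a \<in> carrier A \<Longrightarrow> x a \<le> c a"
  shows "o1_conv type_poset A x l"
  unfolding o1_conv_def net_in_type_poset le_type_poset
proof (intro conjI exI ballI)
  show "index_set A" using assms(1) by (simp add: net_up_type_poset)
qed (use assms in blast)+

text \<open>The hypothesis \<open>conv\<close> is a common consequence of o1-, o2- and o3-continuity
  at \<open>0\<close>: it starts from the strongest mode of convergence and ends in the weakest.
  Each \<open>c g\<close> lies above some \<open>T (w x)\<close>, so a lower bound \<open>z\<close>
  of these values satisfies \<open>z \<le> c g\<close> for all \<open>g\<close>, hence
  \<open>z \<le> 0\<close>; upper bounds are dual.\<close>

lemma vanishing_of_net_convergence:
  fixes T :: "'x::ordered_real_vector \<Rightarrow> 'y::ordered_real_vector" and e :: "'x \<Rightarrow> 'i"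
  assumes e: "inj e" and T0: "T 0 = 0"
    and conv: "\<And>(A::'i gorder) x. o1_conv type_poset A x 0 \<Longrightarrow>
      o3_conv type_poset A (\<lambda>a. T (x a)) (T 0)"
  shows "vanishing T"
proof -
  have main: "(\<forall>x\<in>D. z \<le> T (w x)) \<longrightarrow> z \<le> 0" "(\<forall>x\<in>D. T (w x) \<le> z) \<longrightarrow> 0 \<le> z"
    if D: "down_null D" and w: "\<And>x. x \<in> D \<Longrightarrow> w x \<in> {0..x}" for D w z
  proof -
    obtain J :: "'i gorder" where J: "net_down type_poset J (inv e) 0" "inv e ` carrier J \<subseteq> D"
      using down_null_net[OF e D] .
    have iJ: "index_set J" using J(1) by (simp add: net_down_type_poset)
    have "0 \<le> w (inv e a)" "w (inv e a) \<le> inv e a" if "a \<in> carrier J" for a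
      using J(2) w[of "inv e a"] that by auto
    then have "o1_conv type_poset J (\<lambda>a. w (inv e a)) 0"
      by (rule o1_conv_type_posetI[OF net_up_const[OF iJ] J(1)])
    from conv[OF this] obtain B C :: "'i gorder" and h c \<eta>
      where up: "net_up type_poset B h 0" and down: "net_down type_poset C c 0"
      and eta: "\<eta> \<in> carrier B \<times> carrier C \<rightarrow> carrier J"
      and bnd: "\<And>b g a. b \<in> carrier B \<Longrightarrow> g \<in> carrier C \<Longrightarrow> a \<in> carrier J \<Longrightarrow>
        \<eta> (b, g) \<sqsubseteq>\<^bsub>J\<^esub> a \<Longrightarrow> h b \<le> T (w (inv e a)) \<and> T (w (inv e a)) \<le> c g"
      unfolding o3_conv_def T0 le_type_poset by blast
    interpret J: partial_order J using iJ by (simp add: index_set_def)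
    have bnd': "\<exists>x\<in>D. h b \<le> T (w x) \<and> T (w x) \<le> c g"
      if "b \<in> carrier B" "g \<in> carrier C" for b g
    proof -
      have "\<eta> (b, g) \<in> carrier J" using eta that by auto
      then have "h b \<le> T (w (inv e (\<eta> (b, g)))) \<and> T (w (inv e (\<eta> (b, g)))) \<le> c g"
        "inv e (\<eta> (b, g)) \<in> D"
        using bnd[OF that] J(2) by (auto intro: J.refl)
      then show ?thesis by blast
    qed
    \<comment> \<open>Since \<eta> takes a pair, one of the two indices is frozen while the other
      varies.\<close>
    obtain b0 g0 where b0: "b0 \<in> carrier B" and g0: "g0 \<in> carrier C"
      using up down index_set_nonempty[of B] index_set_nonempty[of C]
      unfolding net_down_type_poset net_up_type_poset by blast
    have c0: "z \<le> (0::'y)" if "\<forall>g\<in>carrier C. z \<le> c g" for z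
      using down that unfolding net_down_type_poset by blast
    have h0: "(0::'y) \<le> z" if "\<forall>b\<in>carrier B. h b \<le> z" for z
      using up that unfolding net_up_type_poset by blast
    show "(\<forall>x\<in>D. z \<le> T (w x)) \<longrightarrow> z \<le> 0"
    proof (intro impI c0 ballI)
      fix g assume z: "\<forall>x\<in>D. z \<le> T (w x)" and g: "g \<in> carrier C"
      obtain x where "x \<in> D" "T (w x) \<le> c g" using bnd'[OF b0 g] by blast
      with z show "z \<le> c g" by (blast intro: order_trans)
    qed
    show "(\<forall>x\<in>D. T (w x) \<le> z) \<longrightarrow> 0 \<le> z"
    proof (intro impI h0 ballI)
      fix b assume z: "\<forall>x\<in>D. T (w x) \<le> z" and b: "b \<in> carrier B"
      obtain x where "x \<in> D" "h b \<le> T (w x)" using bnd'[OF b g0] by blast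
      with z show "h b \<le> z" by (blast intro: order_trans)
    qed
  qed
  show ?thesis by (rule vanishingI) (use main in blast)+
qed

section \<open>Continuity for the order topology\<close>

text \<open>If \<open>z \<le> x\<close> fails, then \<open>z\<close> is no lower bound of a net
  decreasing to \<open>x\<close>; some \<open>c a\<close> is already not above \<open>z\<close>, and
  neither is anything below it.\<close>

lemma order_open_not_ge: "order_open i type_poset {y::'y::order. \<not> z \<le> y}"
  unfolding order_open_def net_catching_def
proof (intro conjI ballI allI impI)
  fix x and A :: "'b gorder" and h c
  assume x: "x \<in> {y. \<not> z \<le> y}" and hc: "net_up type_poset A h x \<and> net_down type_poset A c x"
  then obtain a where "a \<in> carrier A" "\<not> z \<le> c a"
    unfolding net_down_type_poset by blast
  then show "\<exists>a\<in>carrier A. \<lbrace>h a..c a\<rbrace>\<^bsub>type_poset\<^esub> \<subseteq> {y. \<not> z \<le> y}"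
    by (intro bexI[of _ a]) (auto dest: order_trans)
qed simp

lemma order_open_not_le: "order_open i type_poset {y::'y::order. \<not> y \<le> z}"
  unfolding order_open_def net_catching_def
proof (intro conjI ballI allI impI)
  fix x and A :: "'b gorder" and h c
  assume x: "x \<in> {y. \<not> y \<le> z}" and hc: "net_up type_poset A h x \<and> net_down type_poset A c x"
  then obtain a where "a \<in> carrier A" "\<not> h a \<le> z"
    unfolding net_up_type_poset by blast
  then show "\<exists>a\<in>carrier A. \<lbrace>h a..c a\<rbrace>\<^bsub>type_poset\<^esub> \<subseteq> {y. \<not> y \<le> z}"
    by (intro bexI[of _ a]) (auto dest: order_trans)
qed simp

lemma order_continuous_type_poset:
  "order_continuous i type_poset type_poset f \<longleftrightarrow>
     (\<forall>U. order_open i type_poset U \<longrightarrow> order_open i type_poset {x. f x \<in> U})"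
  unfolding order_continuous_def continuous_map_def
  by (simp add: openin_tau_o topspace_tau_o partial_order_type_poset)

text \<open>The preimage of an open set around \<open>0\<close> catches the constant net
  \<open>0\<close> from below together with \<open>D\<close> from above, so it contains a whole
  interval \<open>{0..x}\<close> with \<open>x\<close> in \<open>D\<close>. If a bound
  \<open>z\<close> had the wrong sign, the open set of points violating that bound would contain
  \<open>0\<close>, hence some \<open>T (w x)\<close>.\<close>

lemma vanishing_of_order_continuous:
  fixes T :: "'x::ordered_real_vector \<Rightarrow> 'y::ordered_real_vector" and e :: "'x \<Rightarrow> 'i"
  assumes e: "inj e" and T0: "T 0 = 0"
    and T: "order_continuous TYPE('i) type_poset type_poset T"
  shows "vanishing T"
proof -
  have key: "\<exists>x\<in>D. \<forall>w\<in>{0..x}. T w \<in> U"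
    if U: "order_open TYPE('i) type_poset U" and "0 \<in> U" and D: "down_null D" for D U
  proof -
    obtain J :: "'i gorder" where J: "net_down type_poset J (inv e) 0" "inv e ` carrier J \<subseteq> D"
      using down_null_net[OF e D] .
    have iJ: "index_set J" using J(1) by (simp add: net_down_type_poset)
    have "order_open TYPE('i) type_poset {x. T x \<in> U}"
      using T U by (simp add: order_continuous_type_poset)
    then have "net_catching TYPE('i) type_poset {x. T x \<in> U} 0"
      using \<open>0 \<in> U\<close> T0 by (simp add: order_open_def)
    then obtain a where "a \<in> carrier J" "{0..inv e a} \<subseteq> {x. T x \<in> U}"
      using J(1) net_up_const[OF iJ] unfolding net_catching_def at_least_at_most_type_poset by blast
    then show ?thesis using J(2) by blast
  qed
  show ?thesis
  proof (rule vanishingI)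
    fix D w z
    assume *: "down_null D" "\<And>x. x \<in> D \<Longrightarrow> w x \<in> {0..x}" "\<And>x. x \<in> D \<Longrightarrow> z \<le> T (w x)"
    show "z \<le> 0"
      using key[OF order_open_not_ge _ *(1), of z] *(2,3) by blast
  next
    fix D w z
    assume *: "down_null D" "\<And>x. x \<in> D \<Longrightarrow> w x \<in> {0..x}" "\<And>x. x \<in> D \<Longrightarrow> T (w x) \<le> z"
    show "0 \<le> z"
      using key[OF order_open_not_le _ *(1), of z] *(2,3) by blast
  qed
qed

section \<open>Order bounded operators\<close>

lemma order_bounded_map_iff:
  fixes f :: "'a::order \<Rightarrow> 'b::order"
  shows "order_bounded_map f \<longleftrightarrow> (\<forall>a b. \<exists>c d. \<forall>x\<in>{a..b}. c \<le> f x \<and> f x \<le> d)"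
  unfolding order_bounded_map_def order_bounded_def
proof (intro iffI allI impI)
  fix a b :: 'a
  assume "\<forall>M. (\<exists>a b. M \<subseteq> {a..b}) \<longrightarrow> (\<exists>a b. f ` M \<subseteq> {a..b})"
  then have "\<exists>c d. f ` {a..b} \<subseteq> {c..d}" by blast
  then show "\<exists>c d. \<forall>x\<in>{a..b}. c \<le> f x \<and> f x \<le> d" by (auto simp: image_subset_iff)
next
  fix M :: "'a set"
  assume *: "\<forall>a b. \<exists>c d. \<forall>x\<in>{a..b}. c \<le> f x \<and> f x \<le> d" "\<exists>a b. M \<subseteq> {a..b}"
  then obtain a b where M: "M \<subseteq> {a..b}" by blast
  obtain c d where "\<forall>x\<in>{a..b}. c \<le> f x \<and> f x \<le> d" using *(1) by blast
  with M show "\<exists>a b. f ` M \<subseteq> {a..b}" by (intro exI[of _ c] exI[of _ d]) auto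
qed

lemma Lb_set_diff:
  assumes S: "S \<in> Lb_set" and T: "T \<in> Lb_set"
  shows "(\<lambda>x. S x - T x) \<in> Lb_set"
proof -
  have "\<exists>c d. \<forall>x\<in>{a..b}. c \<le> S x - T x \<and> S x - T x \<le> d" for a b
  proof -
    obtain c d where "\<forall>x\<in>{a..b}. c \<le> S x \<and> S x \<le> d"
      using S unfolding Lb_set_def order_bounded_map_iff by blast
    moreover obtain c' d' where "\<forall>x\<in>{a..b}. c' \<le> T x \<and> T x \<le> d'"
      using T unfolding Lb_set_def order_bounded_map_iff by blast
    ultimately show ?thesis
      by (intro exI[of _ "c - d'"] exI[of _ "d - c'"]) (auto intro: diff_mono)
  qed
  with S T show ?thesis
    by (auto simp: Lb_set_def order_bounded_map_iff linear_compose_sub)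
qed

lemma Lb_set_mono:
  assumes "linear S" "mono S"
  shows "S \<in> Lb_set"
proof -
  have "\<forall>x\<in>{a..b}. S a \<le> S x \<and> S x \<le> S b" for a b
    by (auto intro: monoD[OF assms(2)])
  with assms(1) show ?thesis unfolding Lb_set_def order_bounded_map_iff by blast
qed

lemma Lb_set_zero: "(\<lambda>x. 0) \<in> Lb_set"
  by (rule Lb_set_mono) (auto simp: linear_iff mono_def)

lemma Lb_set_uminus:
  assumes "T \<in> Lb_set"
  shows "(\<lambda>x. - T x) \<in> Lb_set"
  using Lb_set_diff[OF Lb_set_zero assms] by simp

lemma Lb_set_add:
  assumes "S \<in> Lb_set" "T \<in> Lb_set"
  shows "(\<lambda>x. S x + T x) \<in> Lb_set"
  using Lb_set_diff[OF assms(1) Lb_set_uminus[OF assms(2)]] by simp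

section \<open>Extension from the positive cone and the positive part of an operator\<close>

lemma directed_nonneg_upper:
  assumes "directed_in type_poset (UNIV :: 'x::ordered_real_vector set)"
  obtains g where "\<And>x::'x. x \<le> g x" "\<And>x. 0 \<le> g x"
proof -
  have "\<forall>x::'x. \<exists>y. x \<le> y \<and> 0 \<le> y"
    using assms by (simp add: directed_in_def)
  then have "\<exists>g. \<forall>x::'x. x \<le> g x \<and> 0 \<le> g x" by (rule choice)
  then show ?thesis using that by blast
qed

text \<open>Kantorovich's extension argument: by directedness every \<open>x\<close> is the
  difference of the positive elements \<open>g x\<close> and \<open>g x - x\<close>, and additivity
  of \<open>p\<close> makes the resulting value independent of the representation.\<close>

lemma cone_extension:
  fixes p :: "'x::ordered_real_vector \<Rightarrow> 'y::real_vector"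
  assumes dir: "directed_in type_poset (UNIV :: 'x set)"
    and add: "\<And>x y. 0 \<le> x \<Longrightarrow> 0 \<le> y \<Longrightarrow> p (x + y) = p x + p y"
    and scale: "\<And>r x. 0 < r \<Longrightarrow> 0 \<le> x \<Longrightarrow> p (r *\<^sub>R x) = r *\<^sub>R p x"
  obtains S where "linear S" "\<And>x. 0 \<le> x \<Longrightarrow> S x = p x"
proof -
  obtain g where g: "\<And>x::'x. x \<le> g x" "\<And>x. 0 \<le> g x"
    using directed_nonneg_upper[OF dir] by metis
  define S where "S x = p (g x) - p (g x - x)" for x
  \<comment> \<open>Independence of the representation: both \<open>a - b\<close> and
    \<open>g ?x - (g ?x - ?x)\<close> represent \<open>?x\<close>.\<close>
  have S: "S (a - b) = p a - p b" if "0 \<le> a" "0 \<le> b" for a b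
  proof -
    let ?x = "a - b"
    have "p a + p (g ?x - ?x) = p (a + (g ?x - ?x))"
      using add[of a "g ?x - ?x"] that g(1)[of ?x] by simp
    also have "a + (g ?x - ?x) = b + g ?x" by simp
    also have "p (b + g ?x) = p b + p (g ?x)" using add that g by blast
    finally show ?thesis by (simp add: S_def algebra_simps)
  qed
  have p0: "p 0 = 0" using add[of 0 0] by simp
  have "S (x + y) = S x + S y" for x y
  proof -
    have "S (x + y) = S ((g x + g y) - ((g x - x) + (g y - y)))" by (simp add: algebra_simps)
    also have "\<dots> = p (g x + g y) - p ((g x - x) + (g y - y))"
      using g by (intro S) (auto intro: add_nonneg_nonneg)
    also have "\<dots> = S x + S y"
      using add[of "g x" "g y"] add[of "g x - x" "g y - y"] g by (simp add: S_def)
    finally show ?thesis .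
  qed
  moreover have "S (r *\<^sub>R x) = r *\<^sub>R S x" for r x
  proof (cases r "0::real" rule: linorder_cases)
    \<comment> \<open>A negative scalar exchanges the two positive parts of
      \<open>x\<close>.\<close>
    case less
    have "S (r *\<^sub>R x) = S ((- r) *\<^sub>R (g x - x) - (- r) *\<^sub>R g x)" by (simp add: algebra_simps)
    also have "\<dots> = p ((- r) *\<^sub>R (g x - x)) - p ((- r) *\<^sub>R g x)"
      using g less by (intro S scaleR_nonneg_nonneg) auto
    also have "\<dots> = (- r) *\<^sub>R p (g x - x) - (- r) *\<^sub>R p (g x)"
      using scale[of "- r" "g x - x"] scale[of "- r" "g x"] g less by simp
    finally show ?thesis by (simp add: S_def algebra_simps)
  next
    case equal
    then show ?thesis using S[of 0 0] by simp
  next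
    case greater
    have "S (r *\<^sub>R x) = S (r *\<^sub>R g x - r *\<^sub>R (g x - x))" by (simp add: algebra_simps)
    also have "\<dots> = p (r *\<^sub>R g x) - p (r *\<^sub>R (g x - x))"
      using g greater by (intro S scaleR_nonneg_nonneg) auto
    also have "\<dots> = r *\<^sub>R S x"
      using scale[of r "g x - x"] scale[of r "g x"] g greater by (simp add: S_def algebra_simps)
    finally show ?thesis .
  qed
  ultimately have "linear S" by (simp add: linear_iff)
  moreover have "S x = p x" if "0 \<le> x" for x
    using S[OF that, of 0] p0 by simp
  ultimately show ?thesis by (rule that)
qed

text \<open>On the cone \<open>S\<close> is the supremum of \<open>T\<close> over
  \<open>{0..x}\<close>, which exists by order boundedness and Dedekind completeness. Riesz
  decomposition makes it subadditive; superadditivity comes from adding points of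
  \<open>{0..x}\<close> and \<open>{0..y}\<close>. The result is the positive part of
  \<open>T\<close>.\<close>

lemma Riesz_Kantorovich:
  fixes T :: "'x::ordered_real_vector \<Rightarrow> 'y::{ordered_real_vector, conditionally_complete_lattice}"
  assumes dir: "directed_in type_poset (UNIV :: 'x set)"
    and riesz: "riesz_decomposition_property TYPE('x)"
    and T: "T \<in> Lb_set"
  obtains S where "linear S" "\<And>x u. 0 \<le> u \<Longrightarrow> u \<le> x \<Longrightarrow> T u \<le> S x"
    "\<And>x z. 0 \<le> x \<Longrightarrow> (\<And>u. 0 \<le> u \<Longrightarrow> u \<le> x \<Longrightarrow> T u \<le> z) \<Longrightarrow> S x \<le> z"
proof -
  have lin: "linear T" using T by (simp add: Lb_set_def)
  define p where "p x = (SUP u\<in>{0..x}. T u)" for x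
  have "bdd_above (T ` {0..x})" for x
  proof -
    obtain d where "\<forall>u\<in>{0..x}. T u \<le> d"
      using T unfolding Lb_set_def order_bounded_map_iff by blast
    then show ?thesis by (intro bdd_aboveI2) auto
  qed
  then have ge: "T u \<le> p x" if "0 \<le> u" "u \<le> x" for u x
    using that unfolding p_def by (intro cSUP_upper) auto
  have least: "p x \<le> z" if "0 \<le> x" "\<And>u. 0 \<le> u \<Longrightarrow> u \<le> x \<Longrightarrow> T u \<le> z" for x z
    using that unfolding p_def by (intro cSUP_least) auto
  have add: "p (x + y) = p x + p y" if x: "0 \<le> x" and y: "0 \<le> y" for x y
  proof (rule antisym)
    show "p (x + y) \<le> p x + p y"
    proof (rule least)
      fix w assume w: "0 \<le> w" "w \<le> x + y"
      then obtain u v where "u \<in> {0..x}" "v \<in> {0..y}" "w = u + v"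
        using riesz x y unfolding riesz_decomposition_property_def
        by (metis atLeastAtMost_iff)
      then show "T w \<le> p x + p y"
        using ge[of u x] ge[of v y] by (simp add: linear_add[OF lin] add_mono)
    qed (use x y in simp)
    \<comment> \<open>The two suprema are taken one at a time, with the other summand moved to the
      right.\<close>
    have "p x \<le> p (x + y) - p y"
    proof (rule least[OF x])
      fix u assume u: "0 \<le> u" "u \<le> x"
      have "p y \<le> p (x + y) - T u"
      proof (rule least[OF y])
        fix v assume v: "0 \<le> v" "v \<le> y"
        have "T (u + v) \<le> p (x + y)"
          by (rule ge[OF add_nonneg_nonneg[OF u(1) v(1)] add_mono[OF u(2) v(2)]])
        then show "T v \<le> p (x + y) - T u" by (simp add: linear_add[OF lin] le_diff_eq add.commute)
      qed
      then show "T u \<le> p (x + y) - p y" by (simp add: le_diff_eq add.commute)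
    qed
    then show "p x + p y \<le> p (x + y)" by (simp add: le_diff_eq)
  qed
  have scale_le: "p (r *\<^sub>R x) \<le> r *\<^sub>R p x" if r: "0 < r" and x: "0 \<le> x" for r x
  proof (rule least)
    fix u assume u: "0 \<le> u" "u \<le> r *\<^sub>R x"
    have "T (inverse r *\<^sub>R u) \<le> p x"
    proof (rule ge)
      have "inverse r *\<^sub>R u \<le> inverse r *\<^sub>R (r *\<^sub>R x)"
        using u(2) r by (intro scaleR_left_mono) auto
      then show "inverse r *\<^sub>R u \<le> x" using r by simp
    qed (use r u in \<open>auto intro: scaleR_nonneg_nonneg\<close>)
    then have "r *\<^sub>R T (inverse r *\<^sub>R u) \<le> r *\<^sub>R p x"
      using r by (intro scaleR_left_mono) auto
    then show "T u \<le> r *\<^sub>R p x" using r by (simp add: linear_scale[OF lin])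
  qed (use r x in \<open>auto intro: scaleR_nonneg_nonneg\<close>)
  have scale: "p (r *\<^sub>R x) = r *\<^sub>R p x" if r: "0 < r" and x: "0 \<le> x" for r x
  proof (rule antisym)
    \<comment> \<open>The reverse inequality is \<open>scale_le\<close> for the scalar
      \<open>inverse r\<close> at the point \<open>r\<close> times \<open>x\<close>.\<close>
    have "p (inverse r *\<^sub>R (r *\<^sub>R x)) \<le> inverse r *\<^sub>R p (r *\<^sub>R x)"
      using r x by (intro scale_le scaleR_nonneg_nonneg) auto
    then have "r *\<^sub>R p x \<le> r *\<^sub>R (inverse r *\<^sub>R p (r *\<^sub>R x))"
      using r by (intro scaleR_left_mono) auto
    then show "r *\<^sub>R p x \<le> p (r *\<^sub>R x)" using r by simp
  qed (rule scale_le[OF r x])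
  obtain S where S: "linear S" "\<And>x. 0 \<le> x \<Longrightarrow> S x = p x"
    using cone_extension[of p, OF dir add scale] by metis
  show ?thesis
  proof (rule that[OF S(1)])
    show "T u \<le> S x" if "0 \<le> u" "u \<le> x" for x u
      using S(2)[of x] ge[OF that] that by auto
    show "S x \<le> z" if "0 \<le> x" "\<And>u. 0 \<le> u \<Longrightarrow> u \<le> x \<Longrightarrow> T u \<le> z" for x z
      using S(2)[of x] least[OF that] that(1) by auto
  qed
qed

text \<open>Here \<open>P\<close> is the positive part \<open>S\<close> of \<open>T\<close> and
  \<open>Q = S - T\<close> its negative part; once \<open>S\<close> vanishes, so does
  \<open>Q\<close> by \<open>vanishing_diff\<close>.\<close>

lemma vanishing_decomposition:
  fixes T :: "'x::ordered_real_vector \<Rightarrow> 'y::{ordered_real_vector, conditionally_complete_lattice}"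
  assumes dir: "directed_in type_poset (UNIV :: 'x set)"
    and riesz: "riesz_decomposition_property TYPE('x)"
    and T: "T \<in> Lb_set" "vanishing T"
  obtains P Q where "linear P" "mono P" "vanishing P" "linear Q" "mono Q" "vanishing Q"
    "T = (\<lambda>x. P x - Q x)"
proof -
  have lin: "linear T" using T by (simp add: Lb_set_def)
  obtain S where S: "linear S" "\<And>x u. 0 \<le> u \<Longrightarrow> u \<le> x \<Longrightarrow> T u \<le> S x"
    "\<And>x z. 0 \<le> x \<Longrightarrow> (\<And>u. 0 \<le> u \<Longrightarrow> u \<le> x \<Longrightarrow> T u \<le> z) \<Longrightarrow> S x \<le> z"
    using Riesz_Kantorovich[OF dir riesz T(1)] by metis
  have "0 \<le> S x" if "0 \<le> x" for x
    using S(2)[of 0 x] that linear_0[OF lin] by simp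
  then have monoS: "mono S" using linear_mono_iff[OF S(1)] by blast
  have vanS: "vanishing S"
  proof (rule vanishing_mono_I[OF S(1) monoS])
    fix D z assume D: "down_null D" and z: "\<And>x. x \<in> D \<Longrightarrow> z \<le> S x"
    obtain x0 where x0: "x0 \<in> D" using D by (auto simp: down_null_def)
    have pos: "0 \<le> x" if "x \<in> D" for x using D that by (auto simp: down_null_def)
    \<comment> \<open>Leastness of \<open>S x0\<close> is used: it is enough that
      \<open>S x0 - z\<close> still bounds \<open>T\<close> on \<open>{0..x0}\<close>.\<close>
    have "S x0 \<le> S x0 - z"
    proof (rule S(3)[OF pos[OF x0]])
      fix u assume u: "0 \<le> u" "u \<le> x0"
      have "T u - S x0 + z \<le> 0"
      proof (rule vanishing_le_0[OF T(2) down_null_below[OF D x0]])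
        fix x assume x: "x \<in> {x \<in> D. x \<le> x0}"
        then have "0 \<le> x0 - x" "0 \<le> x" "u \<in> {0..(x0 - x) + x}" using u pos by auto
        then obtain v w where v: "v \<in> {0..x0 - x}" and w: "w \<in> {0..x}" and uvw: "u = v + w"
          using riesz unfolding riesz_decomposition_property_def by blast
        have "T v \<le> S (x0 - x)" using S(2) v by auto
        then have "T v + S x \<le> S x0" by (simp add: linear_diff[OF S(1)] le_diff_eq)
        moreover have "T v + z \<le> T v + S x" using z x by simp
        ultimately have "T v + z \<le> S x0" by (rule order_trans[rotated])
        then have "T u - S x0 + z \<le> T w"
          by (simp add: uvw linear_add[OF lin] algebra_simps)
        with w show "\<exists>w\<in>{0..x}. T u - S x0 + z \<le> T w" by blast
      qed
      then show "T u \<le> S x0 - z" by (simp add: algebra_simps)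
    qed
    then show "z \<le> 0" by simp
  qed
  have linQ: "linear (\<lambda>x. S x - T x)" using S(1) lin by (rule linear_compose_sub)
  have monoQ: "mono (\<lambda>x. S x - T x)" unfolding linear_mono_iff[OF linQ] using S(2) by simp
  have vanQ: "vanishing (\<lambda>x. S x - T x)" by (rule vanishing_diff[OF S(1) monoS vanS T(2)])
  show ?thesis
    by (rule that[OF S(1) monoS vanS linQ monoQ vanQ]) simp
qed

lemma vanishing_add:
  fixes S T :: "'x::ordered_real_vector \<Rightarrow> 'y::ordered_real_vector"
  assumes "linear S" "mono S" "vanishing S" "vanishing T"
  shows "vanishing (\<lambda>x. S x + T x)"
  using vanishing_diff[OF assms(1-3) vanishing_uminus[OF assms(4)]] by simp

section \<open>Differences of monotone vanishing operators are continuous\<close>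

text \<open>Monotonicity carries bounds over: \<open>h \<le> x \<le> c\<close> puts
  \<open>P x - Q x\<close> between \<open>P h - Q c\<close> and \<open>P c - Q h\<close>. Vanishing
  makes these new bounds converge.\<close>

locale vanishing_difference =
  fixes P Q :: "'x::ordered_real_vector \<Rightarrow> 'y::ordered_real_vector"
  assumes P: "linear P" "mono P" "vanishing P"
    and Q: "linear Q" "mono Q" "vanishing Q"
begin

text \<open>The widths \<open>c a - h a\<close> form a downward directed set with infimum
  \<open>0\<close>, and the sum of \<open>P\<close> and \<open>Q\<close> vanishes along it.\<close>

lemma le_0_of_net_width:
  assumes up: "net_up type_poset A h l" and down: "net_down type_poset A c l"
    and z: "\<And>a. a \<in> carrier A \<Longrightarrow> z \<le> P (c a - h a) + Q (c a - h a)"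
  shows "z \<le> 0"
proof -
  have A: "index_set A" using up by (simp add: net_up_type_poset)
  \<comment> \<open>The mixed width \<open>c a - h b\<close> serves the infimum, the other two serve
    directedness.\<close>
  have below: "\<exists>d\<in>carrier A. c d - h d \<le> c a - h b \<and> c d - h d \<le> c a - h a \<and> c d - h d \<le> c b - h b"
    if ab: "a \<in> carrier A" "b \<in> carrier A" for a b
  proof -
    obtain d where d: "d \<in> carrier A" "a \<sqsubseteq>\<^bsub>A\<^esub> d" "b \<sqsubseteq>\<^bsub>A\<^esub> d"
      using index_set_upper[OF A ab] .
    then have "h a \<le> h d" "h b \<le> h d" "c d \<le> c a" "c d \<le> c b"
      using ab up down unfolding net_up_type_poset net_down_type_poset by auto
    with d(1) show ?thesis by (intro bexI[of _ d]) (auto intro: diff_mono)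
  qed
  \<comment> \<open>A common lower bound \<open>l'\<close> satisfies
    \<open>l' + h b \<le> c a\<close> for independent \<open>a\<close> and \<open>b\<close>. The
    infimum over \<open>a\<close> and then the supremum over \<open>b\<close> give
    \<open>l \<le> l - l'\<close>.\<close>
  have "l' \<le> 0" if l': "\<forall>a\<in>carrier A. l' \<le> c a - h a" for l'
  proof -
    have "h b \<le> l - l'" if b: "b \<in> carrier A" for b
    proof -
      have "l' + h b \<le> c a" if a: "a \<in> carrier A" for a
        using below[OF a b] l' unfolding le_diff_eq[symmetric] by (blast intro: order_trans)
      then have "l' + h b \<le> l" using down unfolding net_down_type_poset by blast
      then show ?thesis by (simp add: algebra_simps)
    qed
    then have "l \<le> l - l'" using up unfolding net_up_type_poset by blast
    then show ?thesis by simp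
  qed
  moreover have "h a \<le> c a" if "a \<in> carrier A" for a
    using up down that unfolding net_up_type_poset net_down_type_poset by (blast intro: order_trans)
  ultimately have D: "down_null ((\<lambda>a. c a - h a) ` carrier A)"
    using A below unfolding down_null_def index_set_def ball_simps bex_simps
    by (intro conjI) (blast, blast, auto)
  show ?thesis
    by (rule vanishing_mono_le_0[OF vanishing_add[OF P Q(3)] D]) (use z in auto)
qed

text \<open>The distance from \<open>P l - Q l\<close> down to any upper bound \<open>u\<close> is
  at most the value of \<open>P\<close> plus \<open>Q\<close> at every width, hence not
  positive.\<close>

lemma net_up_diff:
  assumes up: "net_up type_poset A h l" and down: "net_down type_poset A c l"
  shows "net_up type_poset A (\<lambda>a. P (h a) - Q (c a)) (P l - Q l)"
  unfolding net_up_type_poset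
proof (intro conjI ballI impI allI)
  show "index_set A" using up by (simp add: net_up_type_poset)
next
  fix a b assume "a \<in> carrier A" "b \<in> carrier A" "b \<sqsubseteq>\<^bsub>A\<^esub> a"
  then show "P (h b) - Q (c b) \<le> P (h a) - Q (c a)"
    using up down unfolding net_up_type_poset net_down_type_poset
    by (intro diff_mono monoD[OF P(2)] monoD[OF Q(2)]) auto
next
  fix a assume "a \<in> carrier A"
  then show "P (h a) - Q (c a) \<le> P l - Q l"
    using up down unfolding net_up_type_poset net_down_type_poset
    by (intro diff_mono monoD[OF P(2)] monoD[OF Q(2)]) auto
next
  fix u assume u: "\<forall>a\<in>carrier A. P (h a) - Q (c a) \<le> u"
  have "P l - Q l - u \<le> 0"
  proof (rule le_0_of_net_width[OF up down])
    fix a assume a: "a \<in> carrier A"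
    then have hl: "h a \<le> l" "l \<le> c a"
      using up down unfolding net_up_type_poset net_down_type_poset by auto
    have "P l - Q l - u \<le> P l - Q l - (P (h a) - Q (c a))"
      using u a by (intro diff_left_mono) auto
    also have "\<dots> = P (l - h a) + Q (c a - l)"
      by (simp add: linear_diff P Q algebra_simps)
    also have "\<dots> \<le> P (c a - h a) + Q (c a - h a)"
      using hl by (intro add_mono monoD[OF P(2)] monoD[OF Q(2)]) (auto intro: diff_mono)
    finally show "P l - Q l - u \<le> P (c a - h a) + Q (c a - h a)" .
  qed
  then show "P l - Q l \<le> u" by simp
qed

lemma net_down_diff:
  assumes up: "net_up type_poset A h l" and down: "net_down type_poset A c l"
  shows "net_down type_poset A (\<lambda>a. P (c a) - Q (h a)) (P l - Q l)"
  unfolding net_down_type_poset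
proof (intro conjI ballI impI allI)
  show "index_set A" using up by (simp add: net_up_type_poset)
next
  fix a b assume "a \<in> carrier A" "b \<in> carrier A" "b \<sqsubseteq>\<^bsub>A\<^esub> a"
  then show "P (c a) - Q (h a) \<le> P (c b) - Q (h b)"
    using up down unfolding net_up_type_poset net_down_type_poset
    by (intro diff_mono monoD[OF P(2)] monoD[OF Q(2)]) auto
next
  fix a assume "a \<in> carrier A"
  then show "P l - Q l \<le> P (c a) - Q (h a)"
    using up down unfolding net_up_type_poset net_down_type_poset
    by (intro diff_mono monoD[OF P(2)] monoD[OF Q(2)]) auto
next
  fix u assume u: "\<forall>a\<in>carrier A. u \<le> P (c a) - Q (h a)"
  have "u - (P l - Q l) \<le> 0"
  proof (rule le_0_of_net_width[OF up down])
    fix a assume a: "a \<in> carrier A"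
    then have hl: "h a \<le> l" "l \<le> c a"
      using up down unfolding net_up_type_poset net_down_type_poset by auto
    have "u - (P l - Q l) \<le> P (c a) - Q (h a) - (P l - Q l)"
      using u a by (intro diff_right_mono) auto
    also have "\<dots> = P (c a - l) + Q (l - h a)"
      by (simp add: linear_diff P Q algebra_simps)
    also have "\<dots> \<le> P (c a - h a) + Q (c a - h a)"
      using hl by (intro add_mono monoD[OF P(2)] monoD[OF Q(2)]) (auto intro: diff_mono)
    finally show "u - (P l - Q l) \<le> P (c a - h a) + Q (c a - h a)" .
  qed
  then show "u \<le> P l - Q l" by simp
qed

lemma bounds:
  assumes "h \<le> x" "x \<le> c"
  shows "P h - Q c \<le> P x - Q x" "P x - Q x \<le> P c - Q h"
  using assms by (auto intro!: diff_mono monoD[OF P(2)] monoD[OF Q(2)])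

lemma o1_continuous: "o1_continuous TYPE('i) type_poset type_poset (\<lambda>x. P x - Q x)"
  unfolding o1_continuous_def
proof (intro allI impI)
  fix A :: "'i gorder" and x and l :: 'x assume "o1_conv type_poset A x l"
  then obtain h c where up: "net_up type_poset A h l" and down: "net_down type_poset A c l"
    and bnd: "\<And>a. a \<in> carrier A \<Longrightarrow> h a \<le> x a \<and> x a \<le> c a" and A: "index_set A"
    unfolding o1_conv_def net_in_type_poset le_type_poset by blast
  show "o1_conv type_poset A (\<lambda>a. P (x a) - Q (x a)) (P l - Q l)"
    by (rule o1_conv_type_posetI[OF net_up_diff[OF up down] net_down_diff[OF up down]])
      (use bounds bnd in blast)+
qed

lemma o2_continuous: "o2_continuous TYPE('i) type_poset type_poset (\<lambda>x. P x - Q x)"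
  unfolding o2_continuous_def
proof (intro allI impI)
  fix A :: "'i gorder" and x and l :: 'x assume "o2_conv type_poset A x l"
  then obtain h c a0 where up: "net_up type_poset A h l" and down: "net_down type_poset A c l"
    and a0: "a0 \<in> carrier A"
    and bnd: "\<And>a. a \<in> carrier A \<Longrightarrow> a0 \<sqsubseteq>\<^bsub>A\<^esub> a \<Longrightarrow> h a \<le> x a \<and> x a \<le> c a"
    and A: "index_set A"
    unfolding o2_conv_def net_in_type_poset le_type_poset by blast
  show "o2_conv type_poset A (\<lambda>a. P (x a) - Q (x a)) (P l - Q l)"
    unfolding o2_conv_def net_in_type_poset le_type_poset
  proof (intro conjI exI bexI ballI impI)
    show "net_up type_poset A (\<lambda>a. P (h a) - Q (c a)) (P l - Q l)" by (rule net_up_diff[OF up down])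
    show "net_down type_poset A (\<lambda>a. P (c a) - Q (h a)) (P l - Q l)" by (rule net_down_diff[OF up down])
    show "index_set A" by (rule A)
    show "a0 \<in> carrier A" by (rule a0)
    fix a assume "a \<in> carrier A" "a0 \<sqsubseteq>\<^bsub>A\<^esub> a"
    then have "h a \<le> x a" "x a \<le> c a" using bnd by auto
    then show "P (h a) - Q (c a) \<le> P (x a) - Q (x a)" "P (x a) - Q (x a) \<le> P (c a) - Q (h a)"
      by (rule bounds)+
  qed
qed

text \<open>The new bounds mix \<open>h\<close> and \<open>c\<close>, so both are indexed by the
  product of \<open>B\<close> and \<open>C\<close>; \<open>o3_conv_universe\<close> brings these
  index sets back into \<open>'i\<close> through the encoding of \<open>'y\<close>.\<close>

lemma o3_continuous:
  fixes e :: "'y \<Rightarrow> 'i"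
  assumes e: "inj e"
  shows "o3_continuous TYPE('i) type_poset type_poset (\<lambda>x. P x - Q x)"
  unfolding o3_continuous_def
proof (intro allI impI)
  fix A :: "'i gorder" and x and l :: 'x assume "o3_conv type_poset A x l"
  then obtain B C :: "'i gorder" and h c \<eta>
    where h: "net_up type_poset B h l" and c: "net_down type_poset C c l"
    and eta: "\<eta> \<in> carrier B \<times> carrier C \<rightarrow> carrier A"
    and bnd: "\<And>b g a. b \<in> carrier B \<Longrightarrow> g \<in> carrier C \<Longrightarrow> a \<in> carrier A \<Longrightarrow>
        \<eta> (b, g) \<sqsubseteq>\<^bsub>A\<^esub> a \<Longrightarrow> h b \<le> x a \<and> x a \<le> c g"
    and A: "index_set A"
    unfolding o3_conv_def net_in_type_poset le_type_poset by blast
  let ?K = "prod_index B C"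
  have K: "carrier ?K = carrier B \<times> carrier C" by (simp add: prod_index_def)
  have up: "net_up type_poset ?K (\<lambda>p. h (fst p)) l"
    by (rule net_up_prod_index[OF h]) (use c in \<open>simp add: net_down_type_poset\<close>)
  have down: "net_down type_poset ?K (\<lambda>p. c (snd p)) l"
    by (rule net_down_prod_index[OF c]) (use h in \<open>simp add: net_up_type_poset\<close>)
  \<comment> \<open>The lower and the upper bound now carry independent pairs \<open>p\<close> and
    \<open>q\<close>, so the new threshold must lie beyond both \<eta>-values.\<close>
  have "\<exists>d\<in>carrier A. \<eta> p \<sqsubseteq>\<^bsub>A\<^esub> d \<and> \<eta> q \<sqsubseteq>\<^bsub>A\<^esub> d"
    if "p \<in> carrier ?K" "q \<in> carrier ?K" for p q
  proof -
    have "\<eta> p \<in> carrier A" "\<eta> q \<in> carrier A" using that eta unfolding K by auto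
    then obtain d where "d \<in> carrier A" "\<eta> p \<sqsubseteq>\<^bsub>A\<^esub> d" "\<eta> q \<sqsubseteq>\<^bsub>A\<^esub> d"
      using index_set_upper[OF A] by blast
    then show ?thesis by blast
  qed
  then obtain d where d: "\<And>p q. p \<in> carrier ?K \<Longrightarrow> q \<in> carrier ?K \<Longrightarrow>
      d p q \<in> carrier A \<and> \<eta> p \<sqsubseteq>\<^bsub>A\<^esub> d p q \<and> \<eta> q \<sqsubseteq>\<^bsub>A\<^esub> d p q"
    by metis
  show "o3_conv type_poset A (\<lambda>a. P (x a) - Q (x a)) (P l - Q l)"
  proof (rule o3_conv_universe[OF partial_order_type_poset e _
        net_up_diff[OF up down] net_down_diff[OF up down], where \<eta> = "\<lambda>(p, q). d p q"])
    show "net_in type_poset A (\<lambda>a. P (x a) - Q (x a))" using A by simp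
    show "(\<lambda>(p, q). d p q) \<in> carrier ?K \<times> carrier ?K \<rightarrow> carrier A" using d by auto
    fix p q a
    assume pq: "p \<in> carrier ?K" "q \<in> carrier ?K" "a \<in> carrier A" "(case (p, q) of (p, q) \<Rightarrow> d p q) \<sqsubseteq>\<^bsub>A\<^esub> a"
    have inA: "\<eta> p \<in> carrier A" "\<eta> q \<in> carrier A" using eta pq(1,2) unfolding K by auto
    have "\<eta> p \<sqsubseteq>\<^bsub>A\<^esub> a" "\<eta> q \<sqsubseteq>\<^bsub>A\<^esub> a"
      using index_set_trans[OF A _ _ _ _ pq(3)] d[OF pq(1,2)] pq(4) inA by auto
    then have p: "h (fst p) \<le> x a \<and> x a \<le> c (snd p)" and q: "h (fst q) \<le> x a \<and> x a \<le> c (snd q)"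
      using bnd[of "fst p" "snd p" a] bnd[of "fst q" "snd q" a] pq unfolding K by auto
    show "P (h (fst p)) - Q (c (snd p)) \<sqsubseteq>\<^bsub>type_poset\<^esub> P (x a) - Q (x a) \<and>
        P (x a) - Q (x a) \<sqsubseteq>\<^bsub>type_poset\<^esub> P (c (snd q)) - Q (h (fst q))"
      using bounds[of "h (fst p)" "x a" "c (snd p)"] bounds[of "h (fst q)" "x a" "c (snd q)"] p q
      by simp
  qed
qed

text \<open>The map sends \<open>{h a..c a}\<close> into the interval between the transported
  bounds, so a set catching the transported nets has a preimage catching the original ones.\<close>

lemma order_continuous: "order_continuous TYPE('i) type_poset type_poset (\<lambda>x. P x - Q x)"
  unfolding order_continuous_type_poset
proof (intro allI impI)
  fix U :: "'y set" assume U: "order_open TYPE('i) type_poset U"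
  show "order_open TYPE('i) type_poset {x. P x - Q x \<in> U}"
    unfolding order_open_def net_catching_def
  proof (intro conjI ballI allI impI)
    fix l and A :: "'i gorder" and h c
    assume l: "l \<in> {x. P x - Q x \<in> U}"
      and "net_up type_poset A h l \<and> net_down type_poset A c l"
    then have up: "net_up type_poset A h l" and down: "net_down type_poset A c l" by auto
    have "net_catching TYPE('i) type_poset U (P l - Q l)"
      using U l unfolding order_open_def by blast
    then obtain a where a: "a \<in> carrier A" "{P (h a) - Q (c a)..P (c a) - Q (h a)} \<subseteq> U"
      using net_up_diff[OF up down] net_down_diff[OF up down]
      unfolding net_catching_def at_least_at_most_type_poset by blast
    have "{h a..c a} \<subseteq> {x. P x - Q x \<in> U}"
      using a(2) bounds by auto
    with a(1) show "\<exists>a\<in>carrier A. \<lbrace>h a..c a\<rbrace>\<^bsub>type_poset\<^esub> \<subseteq> {x. P x - Q x \<in> U}"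
      unfolding at_least_at_most_type_poset by blast
  qed simp
qed

end

section \<open>Order closedness\<close>

text \<open>Given \<open>q\<close> and \<open>r\<close> in \<open>F\<close>, a member
  \<open>s\<close> below both yields \<open>p (x + y) \<le> s x + s y \<le> q x + r y\<close>. Thus
  downward directedness supplies the half of additivity that an infimum lacks in general.\<close>

lemma pointwise_inf:
  fixes F :: "('x::ordered_real_vector \<Rightarrow> 'y::{ordered_real_vector, conditionally_complete_lattice}) set"
  assumes dir: "directed_in type_poset (UNIV :: 'x set)"
    and ne: "F \<noteq> {}" and lin_mono: "\<forall>q\<in>F. linear q \<and> mono q"
    and down: "\<forall>q\<in>F. \<forall>r\<in>F. \<exists>s\<in>F. \<forall>x\<ge>0. s x \<le> q x \<and> s x \<le> r x"
  obtains Q where "linear Q" "mono Q" "\<forall>x\<ge>0. \<forall>q\<in>F. Q x \<le> q x"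
    "\<forall>x\<ge>0. \<forall>z. (\<forall>q\<in>F. z \<le> q x) \<longrightarrow> z \<le> Q x"
proof -
  have F: "linear q \<and> mono q" if "q \<in> F" for q using lin_mono that by blast
  define p where "p x = (INF q\<in>F. q x)" for x
  have pos: "0 \<le> q x" if "q \<in> F" "0 \<le> x" for q x
    using linear_nonneg[of q x] F[OF that(1)] that(2) by simp
  have le: "p x \<le> q x" if "0 \<le> x" "q \<in> F" for x q
    unfolding p_def using that pos by (intro cINF_lower bdd_belowI2[where m = 0]) auto
  have greatest: "z \<le> p x" if "\<And>q. q \<in> F \<Longrightarrow> z \<le> q x" for x z
    unfolding p_def using that ne by (intro cINF_greatest) auto
  have add: "p (x + y) = p x + p y" if x: "0 \<le> x" and y: "0 \<le> y" for x y
  proof (rule antisym)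
    have "p (x + y) - p x \<le> p y"
    proof (rule greatest)
      fix r assume r: "r \<in> F"
      have "p (x + y) - r y \<le> p x"
      proof (rule greatest)
        fix q assume q: "q \<in> F"
        obtain s where s: "s \<in> F" "\<forall>x\<ge>0. s x \<le> q x \<and> s x \<le> r x" using down q r by blast
        have "p (x + y) \<le> s (x + y)" using le s x y by simp
        also have "\<dots> = s x + s y" using F[OF s(1)] by (simp add: linear_add)
        also have "\<dots> \<le> q x + r y" using s x y by (intro add_mono) auto
        finally show "p (x + y) - r y \<le> q x" by (simp add: algebra_simps)
      qed
      then show "p (x + y) - p x \<le> r y" by (simp add: algebra_simps)
    qed
    then show "p (x + y) \<le> p x + p y" by (simp add: algebra_simps)
    show "p x + p y \<le> p (x + y)"
    proof (rule greatest)
      fix q assume q: "q \<in> F"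
      then show "p x + p y \<le> q (x + y)"
        using F[OF q] le[OF x q] le[OF y q] by (simp add: linear_add add_mono)
    qed
  qed
  have scale_ge: "r *\<^sub>R p x \<le> p (r *\<^sub>R x)" if r: "0 < r" and x: "0 \<le> x" for r x
  proof (rule greatest)
    fix q assume q: "q \<in> F"
    have "r *\<^sub>R p x \<le> r *\<^sub>R q x" using le[OF x q] r by (intro scaleR_left_mono) auto
    then show "r *\<^sub>R p x \<le> q (r *\<^sub>R x)" using F[OF q] by (simp add: linear_scale)
  qed
  have scale: "p (r *\<^sub>R x) = r *\<^sub>R p x" if r: "0 < r" and x: "0 \<le> x" for r x
  proof (rule antisym)
    have "inverse r *\<^sub>R p (r *\<^sub>R x) \<le> p (inverse r *\<^sub>R (r *\<^sub>R x))"
      using r x by (intro scale_ge scaleR_nonneg_nonneg) auto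
    then have "r *\<^sub>R (inverse r *\<^sub>R p (r *\<^sub>R x)) \<le> r *\<^sub>R p x"
      using r by (intro scaleR_left_mono) auto
    then show "p (r *\<^sub>R x) \<le> r *\<^sub>R p x" using r by simp
  qed (rule scale_ge[OF r x])
  obtain Q where Q: "linear Q" "\<And>x. 0 \<le> x \<Longrightarrow> Q x = p x"
    using cone_extension[of p, OF dir add scale] by metis
  show ?thesis
  proof (rule that[OF Q(1)])
    show "mono Q" unfolding linear_mono_iff[OF Q(1)] using Q(2) greatest pos by auto
  qed (use Q(2) le greatest in auto)
qed

section \<open>Order limits in the space of order bounded operators\<close>

lemma carrier_Lb [simp]: "carrier Lb = Lb_set"
  by (simp add: Lb_def)

lemma le_Lb [simp]: "S \<sqsubseteq>\<^bsub>Lb\<^esub> T \<longleftrightarrow> (\<forall>x\<ge>0. S x \<le> T x)"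
  by (simp add: Lb_def)

lemma is_sup_Lb:
  assumes "is_sup Lb F T"
  shows "T \<in> Lb_set" "\<And>R. R \<in> Lb_set \<Longrightarrow> (\<And>S. S \<in> F \<Longrightarrow> \<forall>x\<ge>0. S x \<le> R x) \<Longrightarrow> \<forall>x\<ge>0. T x \<le> R x"
  using assms unfolding is_sup_def least_def Upper_def by auto

lemma is_inf_Lb:
  assumes "is_inf Lb F T"
  shows "T \<in> Lb_set" "\<And>R. R \<in> Lb_set \<Longrightarrow> (\<And>S. S \<in> F \<Longrightarrow> \<forall>x\<ge>0. R x \<le> S x) \<Longrightarrow> \<forall>x\<ge>0. R x \<le> T x"
  using assms unfolding is_inf_def greatest_def Lower_def by auto

text \<open>Turns convergence in \<open>Lb\<close> into a statement at each positive
  \<open>x\<close>. The pointwise infimum \<open>Q\<close> of the positive operators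
  \<open>c a - h a\<close> lies in \<open>Lb\<close>, and \<open>Q + h b\<close> is below every
  \<open>c a\<close>, hence below \<open>T\<close>. So \<open>T - Q\<close> bounds all
  \<open>h b\<close>, which forces \<open>T \<le> T - Q\<close> on the cone.\<close>

lemma net_width_Lb:
  fixes h c :: "'i \<Rightarrow> 'x::ordered_real_vector \<Rightarrow> 'y::{ordered_real_vector, conditionally_complete_lattice}"
  assumes dir: "directed_in type_poset (UNIV :: 'x set)"
    and up: "net_up Lb A h T" and down: "net_down Lb A c T"
    and x: "0 \<le> x" and z: "\<And>a. a \<in> carrier A \<Longrightarrow> z \<le> c a x - h a x"
  shows "z \<le> 0"
proof -
  have A: "index_set A" using up by (simp add: net_up_def net_in_def)
  have Lb: "h a \<in> Lb_set" "c a \<in> Lb_set" if "a \<in> carrier A" for a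
    using up down that by (auto simp: net_up_def net_down_def net_in_def)
  have sup: "is_sup Lb (h ` carrier A) T" using up by (simp add: net_up_def)
  have inf: "is_inf Lb (c ` carrier A) T" using down by (simp add: net_down_def)
  have hT: "\<forall>x\<ge>0. h a x \<le> T x" if "a \<in> carrier A" for a
    using sup that Lb unfolding is_sup_def least_def Upper_def by auto
  have Tc: "\<forall>x\<ge>0. T x \<le> c a x" if "a \<in> carrier A" for a
    using inf that Lb unfolding is_inf_def greatest_def Lower_def by auto
  have below: "\<exists>d\<in>carrier A. \<forall>x\<ge>0. c d x \<le> c a x \<and> h a x \<le> h d x \<and> c d x \<le> c b x \<and> h b x \<le> h d x"
    if ab: "a \<in> carrier A" "b \<in> carrier A" for a b
  proof -
    obtain d where d: "d \<in> carrier A" "a \<sqsubseteq>\<^bsub>A\<^esub> d" "b \<sqsubseteq>\<^bsub>A\<^esub> d"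
      using index_set_upper[OF A ab] .
    then show ?thesis
      using ab up down unfolding net_up_def net_down_def by (intro bexI[of _ d]) auto
  qed
  let ?F = "(\<lambda>a x. c a x - h a x) ` carrier A"
  have F: "\<forall>q\<in>?F. linear q \<and> mono q"
  proof
    fix q assume "q \<in> ?F"
    then obtain a where a: "a \<in> carrier A" and q: "q = (\<lambda>x. c a x - h a x)" by auto
    have "linear q" using Lb[OF a] by (simp add: q Lb_set_def linear_compose_sub)
    moreover have "\<forall>x\<ge>0. 0 \<le> q x" using hT[OF a] Tc[OF a] by (auto simp: q intro: order_trans)
    ultimately show "linear q \<and> mono q" using linear_mono_iff by blast
  qed
  have ne: "?F \<noteq> {}" using A by (simp add: index_set_def)
  have dF: "\<forall>q\<in>?F. \<forall>r\<in>?F. \<exists>s\<in>?F. \<forall>x\<ge>0. s x \<le> q x \<and> s x \<le> r x"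
  proof (intro ballI)
    fix q r assume "q \<in> ?F" "r \<in> ?F"
    then obtain a b where ab: "a \<in> carrier A" "b \<in> carrier A"
      and q: "q = (\<lambda>x. c a x - h a x)" and r: "r = (\<lambda>x. c b x - h b x)" by auto
    obtain d where d: "d \<in> carrier A"
      "\<forall>x\<ge>0. c d x \<le> c a x \<and> h a x \<le> h d x \<and> c d x \<le> c b x \<and> h b x \<le> h d x"
      using below[OF ab] by blast
    show "\<exists>s\<in>?F. \<forall>x\<ge>0. s x \<le> q x \<and> s x \<le> r x"
      by (intro bexI[of _ "\<lambda>x. c d x - h d x"]) (use d in \<open>auto simp: q r intro: diff_mono\<close>)
  qed
  obtain Q where Q: "linear Q" "mono Q" "\<forall>x\<ge>0. \<forall>q\<in>?F. Q x \<le> q x"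
    "\<forall>x\<ge>0. \<forall>z. (\<forall>q\<in>?F. z \<le> q x) \<longrightarrow> z \<le> Q x"
    using pointwise_inf[OF dir ne F dF] .
  have QLb: "Q \<in> Lb_set" using Q(1,2) by (rule Lb_set_mono)
  have TLb: "T \<in> Lb_set" using is_inf_Lb(1)[OF inf] .
  have hTQ: "\<forall>x\<ge>0. h b x \<le> T x - Q x" if b: "b \<in> carrier A" for b
  proof -
    have "\<forall>x\<ge>0. Q x + h b x \<le> T x"
    proof (rule is_inf_Lb(2)[OF inf Lb_set_add[OF QLb Lb(1)[OF b]]])
      fix S assume "S \<in> c ` carrier A"
      then obtain a where a: "a \<in> carrier A" and S: "S = c a" by auto
      show "\<forall>x\<ge>0. Q x + h b x \<le> S x"
      proof (intro allI impI)
        fix x :: 'x assume x: "0 \<le> x"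
        obtain d where d: "d \<in> carrier A"
          "\<forall>x\<ge>0. c d x \<le> c a x \<and> h a x \<le> h d x \<and> c d x \<le> c b x \<and> h b x \<le> h d x"
          using below[OF a b] by blast
        have "Q x \<le> c d x - h d x" using Q(3) x d(1) by auto
        also have "\<dots> \<le> c a x - h b x" using d(2) x by (intro diff_mono) auto
        finally show "Q x + h b x \<le> S x" by (simp add: S algebra_simps)
      qed
    qed
    then show ?thesis by (simp add: algebra_simps)
  qed
  have "\<forall>x\<ge>0. T x \<le> T x - Q x"
    by (rule is_sup_Lb(2)[OF sup Lb_set_diff[OF TLb QLb]]) (use hTQ in auto)
  then have "Q x \<le> 0" using x by simp
  moreover have "z \<le> Q x" using Q(4) x z by auto
  ultimately show ?thesis by (rule order_trans[rotated])
qed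

text \<open>If every interval between \<open>h a\<close> and \<open>c a\<close> met the set, there
  would be vanishing \<open>R a\<close> in each of them. On \<open>{0..x0}\<close> the operators
  \<open>T\<close> and \<open>R a\<close> differ by at most the width at \<open>x0\<close>, and by
  \<open>net_width_Lb\<close> no positive element lies below all these widths, so \<open>T\<close>
  would vanish.\<close>

lemma order_closed_vanishing:
  assumes dir: "directed_in type_poset (UNIV :: 'x set)"
  shows "order_closed TYPE('i) Lb {T \<in> Lb_set. vanishing
    (T :: 'x::ordered_real_vector \<Rightarrow> 'y::{ordered_real_vector, conditionally_complete_lattice})}"
    (is "order_closed _ _ ?M")
  unfolding order_closed_def order_open_def net_catching_def
proof (intro conjI ballI allI impI)
  fix T and A :: "'i gorder" and h c
  assume T: "T \<in> carrier Lb - ?M" and "net_up Lb A h T \<and> net_down Lb A c T"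
  then have up: "net_up Lb A h T" and down: "net_down Lb A c T" by auto
  show "\<exists>a\<in>carrier A. \<lbrace>h a..c a\<rbrace>\<^bsub>Lb\<^esub> \<subseteq> carrier Lb - ?M"
  proof (rule ccontr)
    assume "\<not> ?thesis"
    then have "\<forall>a\<in>carrier A. \<exists>R\<in>\<lbrace>h a..c a\<rbrace>\<^bsub>Lb\<^esub>. R \<in> ?M \<or> R \<notin> carrier Lb" by blast
    then have "\<forall>a\<in>carrier A. \<exists>R. R \<in> \<lbrace>h a..c a\<rbrace>\<^bsub>Lb\<^esub> \<and> vanishing R"
      by (auto simp: at_least_at_most_def)
    then obtain R where "\<forall>a\<in>carrier A. R a \<in> \<lbrace>h a..c a\<rbrace>\<^bsub>Lb\<^esub> \<and> vanishing (R a)"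
      unfolding bchoice_iff by blast
    then have R: "\<And>a. a \<in> carrier A \<Longrightarrow> vanishing (R a)"
      "\<And>a x. a \<in> carrier A \<Longrightarrow> 0 \<le> x \<Longrightarrow> h a x \<le> R a x \<and> R a x \<le> c a x"
      by (simp_all add: at_least_at_most_def)
    have Lb: "h a \<in> Lb_set" "c a \<in> Lb_set" if "a \<in> carrier A" for a
      using up down that by (auto simp: net_up_def net_down_def net_in_def)
    have hT: "h a x \<le> T x" and Tc: "T x \<le> c a x" if "a \<in> carrier A" "0 \<le> x" for a x
      using up down that Lb unfolding net_up_def net_down_def
        is_sup_def least_def Upper_def is_inf_def greatest_def Lower_def by auto
    \<comment> \<open>The operator \<open>c a - h a\<close> is positive, so its value at
      \<open>x0\<close> controls the error at all selected points below \<open>x0\<close> at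
      once.\<close>
    have width: "c a w - h a w \<le> c a x - h a x" if a: "a \<in> carrier A" and "0 \<le> w" "w \<le> x" for a w x
    proof -
      have "h a (x - w) \<le> c a (x - w)"
        using hT[OF a] Tc[OF a] that by (auto intro: order_trans[of _ "T (x - w)"])
      then show ?thesis using Lb[OF a] by (simp add: Lb_set_def linear_diff algebra_simps)
    qed
    have "vanishing T"
    proof (rule vanishingI)
      fix D w z
      assume D: "down_null D" and w: "\<And>x. x \<in> D \<Longrightarrow> w x \<in> {0..x}"
        and z: "\<And>x. x \<in> D \<Longrightarrow> z \<le> T (w x)"
      obtain x0 where x0: "x0 \<in> D" using D by (auto simp: down_null_def)
      have "0 \<le> x0" using D x0 by (auto simp: down_null_def)
      then show "z \<le> 0"
      proof (rule net_width_Lb[OF dir up down])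
        fix a assume a: "a \<in> carrier A"
        \<comment> \<open>Lowered by the error, \<open>z\<close> becomes a lower bound for values of
          \<open>R a\<close>, which vanishes.\<close>
        have "z - (c a x0 - h a x0) \<le> 0"
        proof (rule vanishing_le_0[OF R(1)[OF a] down_null_below[OF D x0]])
          fix x assume x: "x \<in> {x \<in> D. x \<le> x0}"
          then have wx: "0 \<le> w x" "w x \<le> x0" using w[of x] by auto
          have "z - (c a x0 - h a x0) \<le> T (w x) - (c a (w x) - h a (w x))"
            by (rule diff_mono[OF z width[OF a wx]]) (use x in simp)
          also have "\<dots> = h a (w x) - (c a (w x) - T (w x))" by (simp add: algebra_simps)
          also have "\<dots> \<le> R a (w x) - 0"
            using R(2)[OF a wx(1)] Tc[OF a wx(1)] by (intro diff_mono) auto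
          finally have "z - (c a x0 - h a x0) \<le> R a (w x)" by simp
          with w[of x] x show "\<exists>w\<in>{0..x}. z - (c a x0 - h a x0) \<le> R a w" by blast
        qed
        then show "z \<le> c a x0 - h a x0" by simp
      qed
    next
      fix D w z
      assume D: "down_null D" and w: "\<And>x. x \<in> D \<Longrightarrow> w x \<in> {0..x}"
        and z: "\<And>x. x \<in> D \<Longrightarrow> T (w x) \<le> z"
      obtain x0 where x0: "x0 \<in> D" using D by (auto simp: down_null_def)
      have "0 \<le> x0" using D x0 by (auto simp: down_null_def)
      then have "- z \<le> 0"
      proof (rule net_width_Lb[OF dir up down])
        fix a assume a: "a \<in> carrier A"
        have "0 \<le> z + (c a x0 - h a x0)"
        proof (rule vanishing_ge_0[OF R(1)[OF a] down_null_below[OF D x0]])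
          fix x assume x: "x \<in> {x \<in> D. x \<le> x0}"
          then have wx: "0 \<le> w x" "w x \<le> x0" using w[of x] by auto
          have "R a (w x) \<le> c a (w x) + (T (w x) - h a (w x))"
            using R(2)[OF a wx(1)] hT[OF a wx(1)] by (simp add: add_increasing2)
          also have "\<dots> = T (w x) + (c a (w x) - h a (w x))" by (simp add: algebra_simps)
          also have "\<dots> \<le> z + (c a x0 - h a x0)"
            by (rule add_mono[OF z width[OF a wx]]) (use x in simp)
          finally have "R a (w x) \<le> z + (c a x0 - h a x0)" .
          with w[of x] x show "\<exists>w\<in>{0..x}. R a w \<le> z + (c a x0 - h a x0)" by blast
        qed
        then show "- z \<le> c a x0 - h a x0" by (metis add.commute diff_0 diff_le_eq)
      qed
      then show "0 \<le> z" by simp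
    qed
    with T show False by auto
  qed
qed auto

section \<open>The ideal of order continuous operators\<close>

text \<open>Directedness comes from adding the positive parts of two members. Fullness rests on
  domination: for \<open>R\<close> between \<open>S\<close> and \<open>T\<close>, the positive
  operator \<open>T - R\<close> is at most \<open>T - S\<close> on the cone.\<close>

lemma order_ideal_vanishing:
  assumes dir: "directed_in type_poset (UNIV :: 'x set)"
    and riesz: "riesz_decomposition_property TYPE('x)"
  shows "order_ideal Lb {T \<in> Lb_set. vanishing
    (T :: 'x::ordered_real_vector \<Rightarrow> 'y::{ordered_real_vector, conditionally_complete_lattice})}"
    (is "order_ideal _ ?M")
proof -
  have uminus: "(\<lambda>x. - T x) \<in> ?M" if "T \<in> ?M" for T
    using that Lb_set_uminus vanishing_uminus by blast
  have add: "(\<lambda>x. S x + T x) \<in> ?M" if S: "S \<in> ?M" and T: "T \<in> ?M" for S T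
  proof -
    obtain P Q where P: "linear P" "mono P" "vanishing P"
      and Q: "linear Q" "mono Q" "vanishing Q" and SPQ: "S = (\<lambda>x. P x - Q x)"
      using vanishing_decomposition[OF dir riesz] S by blast
    \<comment> \<open>This bracketing of the sum gives each subtraction a monotone minuend, as
      \<open>vanishing_diff\<close> requires.\<close>
    have "vanishing (\<lambda>x. P x - (Q x - T x))"
      using T by (intro vanishing_diff P Q) auto
    then have "vanishing (\<lambda>x. S x + T x)" by (simp add: SPQ algebra_simps)
    with S T show ?thesis using Lb_set_add by blast
  qed
  have sub: "additive_subgroup_in (carrier Lb) ?M"
    unfolding additive_subgroup_in_def
  proof (intro conjI ballI)
    show "0 \<in> ?M" using Lb_set_zero vanishing_zero by (simp add: zero_fun_def)
    show "S + T \<in> ?M" if "S \<in> ?M" "T \<in> ?M" for S T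
      using add[OF that] by (simp add: plus_fun_def)
    show "- T \<in> ?M" if "T \<in> ?M" for T
      using uminus[OF that] by (simp add: fun_Compl_def)
  qed auto
  moreover have "directed_in Lb ?M"
    unfolding directed_in_def
  proof (intro ballI)
    fix S T assume ST: "S \<in> ?M" "T \<in> ?M"
    obtain P Q where P: "linear P" "mono P" "vanishing P"
      and Q: "linear Q" "mono Q" "vanishing Q" and S: "S = (\<lambda>x. P x - Q x)"
      using vanishing_decomposition[OF dir riesz] ST(1) by blast
    obtain P' Q' where P': "linear P'" "mono P'" "vanishing P'"
      and Q': "linear Q'" "mono Q'" "vanishing Q'" and T: "T = (\<lambda>x. P' x - Q' x)"
      using vanishing_decomposition[OF dir riesz] ST(2) by blast
    have "(\<lambda>x. P x + P' x) \<in> ?M" using P P' Lb_set_mono by (intro add) auto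
    moreover have "S x \<le> P x + P' x" "T x \<le> P x + P' x" if "0 \<le> x" for x
    proof -
      have nn: "0 \<le> P x" "0 \<le> P' x" "0 \<le> Q x" "0 \<le> Q' x"
        using that by (auto intro: linear_nonneg[OF P(1,2)] linear_nonneg[OF P'(1,2)]
          linear_nonneg[OF Q(1,2)] linear_nonneg[OF Q'(1,2)])
      have "S x \<le> P x" "T x \<le> P' x" using nn by (simp_all add: S T)
      with nn show "S x \<le> P x + P' x" "T x \<le> P x + P' x"
        by (auto intro: add_increasing add_increasing2)
    qed
    ultimately show "\<exists>R\<in>?M. S \<sqsubseteq>\<^bsub>Lb\<^esub> R \<and> T \<sqsubseteq>\<^bsub>Lb\<^esub> R" by auto
  qed
  moreover have "full_in Lb ?M"
    unfolding full_in_def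
  proof (intro ballI subsetI)
    fix S T R assume ST: "S \<in> ?M" "T \<in> ?M" and "R \<in> \<lbrace>S..T\<rbrace>\<^bsub>Lb\<^esub>"
    then have R: "R \<in> Lb_set" "\<And>x. 0 \<le> x \<Longrightarrow> S x \<le> R x \<and> R x \<le> T x"
      by (auto simp: at_least_at_most_def)
    have van: "vanishing (\<lambda>x. T x + - S x)" using add[OF ST(2) uminus[OF ST(1)]] by simp
    have lin: "linear (\<lambda>x. T x - R x)"
      using ST(2) R(1) by (simp add: Lb_set_def linear_compose_sub)
    have mon: "mono (\<lambda>x. T x - R x)" unfolding linear_mono_iff[OF lin] using R(2) by simp
    have vanTR: "vanishing (\<lambda>x. T x - R x)"
    proof (rule vanishing_mono_I[OF lin mon])
      fix D z assume D: "down_null D" and z: "\<And>x. x \<in> D \<Longrightarrow> z \<le> T x - R x"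
      show "z \<le> 0"
      proof (rule vanishing_mono_le_0[OF van D])
        fix x assume x: "x \<in> D"
        then have "0 \<le> x" using D by (auto simp: down_null_def)
        then have "T x - R x \<le> T x - S x" using R(2) by (intro diff_left_mono) auto
        with z[OF x] have "z \<le> T x - S x" by (rule order_trans)
        then show "z \<le> T x + - S x" by simp
      qed
    qed
    \<comment> \<open>\<open>R\<close> is rewritten so that the monotone operator
      \<open>T - R\<close> is the minuend.\<close>
    have "vanishing (\<lambda>x. - ((T x - R x) - T x))"
      by (rule vanishing_uminus[OF vanishing_diff[OF lin mon vanTR]]) (use ST(2) in simp)
    with R(1) show "R \<in> ?M" by simp
  qed
  ultimately show ?thesis by (simp add: order_ideal_def)
qed

text \<open>The embedding of \<open>'x\<close> provides enough test nets in \<open>'i\<close> to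
  force vanishing; the embedding of \<open>'y\<close> keeps the o3-bounds of image nets inside
  \<open>'i\<close>. All operator sets are compared with the vanishing members of
  \<open>Lb_set\<close>.\<close>

theorem theorem9p6:
  fixes embX :: "'x::ordered_real_vector \<Rightarrow> 'i"
    and embY :: "'y::{ordered_real_vector, conditionally_complete_lattice} \<Rightarrow> 'i"
  assumes universe_X: "inj embX" and universe_Y: "inj embY"
    and directed: "directed_in type_poset (UNIV :: 'x set)"
    and riesz: "riesz_decomposition_property TYPE('x)"
  shows "(Lb_o1 TYPE('i) :: ('x \<Rightarrow> 'y) set) = Lb_o2 TYPE('i)
    \<and> (Lb_o2 TYPE('i) :: ('x \<Rightarrow> 'y) set) = Lb_o3 TYPE('i)
    \<and> (Lb_o3 TYPE('i) :: ('x \<Rightarrow> 'y) set) = Lb_tau TYPE('i)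
    \<and> (Lb_tau TYPE('i) :: ('x \<Rightarrow> 'y) set)
        = difference_set (Lpos_oc TYPE('i)) (Lpos_oc TYPE('i))
    \<and> order_ideal Lb (Lb_tau TYPE('i) :: ('x \<Rightarrow> 'y) set)
    \<and> order_closed TYPE('i) Lb (Lb_tau TYPE('i) :: ('x \<Rightarrow> 'y) set)"
proof -
  let ?M = "{T \<in> Lb_set. vanishing (T :: 'x \<Rightarrow> 'y)}"
  have T0: "T 0 = 0" if "T \<in> Lb_set" for T :: "'x \<Rightarrow> 'y"
    using that by (auto simp: Lb_set_def intro: linear_0)
  have decomp: "\<exists>P Q. vanishing_difference P Q \<and> T = (\<lambda>x. P x - Q x)" if "T \<in> ?M"
    for T :: "'x \<Rightarrow> 'y"
    using vanishing_decomposition[OF directed riesz, of T] that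
    unfolding vanishing_difference_def by blast
  have M_vanishing: "T \<in> ?M"
    if "T \<in> Lb_set" "\<And>(A::'i gorder) x. o1_conv type_poset A x 0 \<Longrightarrow>
      o3_conv type_poset A (\<lambda>a. T (x a)) (T 0)" for T :: "'x \<Rightarrow> 'y"
  proof -
    have "vanishing T"
      by (rule vanishing_of_net_convergence[where T = T, OF universe_X T0[OF that(1)]]) (rule that(2))
    with that(1) show ?thesis by simp
  qed
  have o1: "Lb_o1 TYPE('i) = ?M"
  proof (intro equalityI subsetI)
    fix T :: "'x \<Rightarrow> 'y" assume T: "T \<in> Lb_o1 TYPE('i)"
    show "T \<in> ?M"
    proof (rule M_vanishing)
      show "T \<in> Lb_set" using T by (simp add: Lb_o1_def)
      fix A :: "'i gorder" and x :: "'i \<Rightarrow> 'x" assume o1: "o1_conv type_poset A x 0"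
      have "o1_conv type_poset A (\<lambda>a. T (x a)) (T 0)"
        using T o1 by (simp add: Lb_o1_def o1_continuous_def)
      then show "o3_conv type_poset A (\<lambda>a. T (x a)) (T 0)"
        by (rule o2_conv_imp_o3_conv[OF o1_conv_imp_o2_conv])
    qed
  next
    fix T :: "'x \<Rightarrow> 'y" assume T: "T \<in> ?M"
    obtain P Q where "vanishing_difference P Q" "T = (\<lambda>x. P x - Q x)" using decomp[OF T] by blast
    with T show "T \<in> Lb_o1 TYPE('i)"
      using vanishing_difference.o1_continuous by (simp add: Lb_o1_def)
  qed
  have o2: "Lb_o2 TYPE('i) = ?M"
  proof (intro equalityI subsetI)
    fix T :: "'x \<Rightarrow> 'y" assume T: "T \<in> Lb_o2 TYPE('i)"
    show "T \<in> ?M"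
    proof (rule M_vanishing)
      show "T \<in> Lb_set" using T by (simp add: Lb_o2_def)
      fix A :: "'i gorder" and x :: "'i \<Rightarrow> 'x" assume o1: "o1_conv type_poset A x 0"
      have "o2_conv type_poset A (\<lambda>a. T (x a)) (T 0)"
        using T o1_conv_imp_o2_conv[OF o1] by (simp add: Lb_o2_def o2_continuous_def)
      then show "o3_conv type_poset A (\<lambda>a. T (x a)) (T 0)"
        by (rule o2_conv_imp_o3_conv)
    qed
  next
    fix T :: "'x \<Rightarrow> 'y" assume T: "T \<in> ?M"
    obtain P Q where "vanishing_difference P Q" "T = (\<lambda>x. P x - Q x)" using decomp[OF T] by blast
    with T show "T \<in> Lb_o2 TYPE('i)"
      using vanishing_difference.o2_continuous by (simp add: Lb_o2_def)
  qed
  have o3: "Lb_o3 TYPE('i) = ?M"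
  proof (intro equalityI subsetI)
    fix T :: "'x \<Rightarrow> 'y" assume T: "T \<in> Lb_o3 TYPE('i)"
    show "T \<in> ?M"
    proof (rule M_vanishing)
      show "T \<in> Lb_set" using T by (simp add: Lb_o3_def)
      fix A :: "'i gorder" and x :: "'i \<Rightarrow> 'x" assume o1: "o1_conv type_poset A x 0"
      show "o3_conv type_poset A (\<lambda>a. T (x a)) (T 0)"
        using T o2_conv_imp_o3_conv[OF o1_conv_imp_o2_conv[OF o1]]
        by (simp add: Lb_o3_def o3_continuous_def)
    qed
  next
    fix T :: "'x \<Rightarrow> 'y" assume T: "T \<in> ?M"
    obtain P Q where "vanishing_difference P Q" "T = (\<lambda>x. P x - Q x)" using decomp[OF T] by blast
    with T show "T \<in> Lb_o3 TYPE('i)"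
      using vanishing_difference.o3_continuous[OF _ universe_Y] by (simp add: Lb_o3_def)
  qed
  have tau: "Lb_tau TYPE('i) = ?M"
  proof (intro equalityI subsetI)
    fix T :: "'x \<Rightarrow> 'y" assume "T \<in> Lb_tau TYPE('i)"
    then have T: "T \<in> Lb_set" "order_continuous TYPE('i) type_poset type_poset T"
      by (simp_all add: Lb_tau_def)
    then show "T \<in> ?M"
      using vanishing_of_order_continuous[where T = T, OF universe_X T0[OF T(1)] T(2)] by simp
  next
    fix T :: "'x \<Rightarrow> 'y" assume T: "T \<in> ?M"
    obtain P Q where "vanishing_difference P Q" "T = (\<lambda>x. P x - Q x)" using decomp[OF T] by blast
    with T show "T \<in> Lb_tau TYPE('i)"
      using vanishing_difference.order_continuous by (simp add: Lb_tau_def)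
  qed
  \<comment> \<open>Monotone linear maps are order bounded, so \<open>tau\<close> identifies order
    continuity with vanishing for them.\<close>
  have pos: "S \<in> Lpos_oc TYPE('i) \<longleftrightarrow> linear S \<and> mono S \<and> vanishing S" for S :: "'x \<Rightarrow> 'y"
    using tau Lb_set_mono[of S] by (auto simp: Lpos_oc_def Lb_tau_def)
  have diff: "?M = difference_set (Lpos_oc TYPE('i)) (Lpos_oc TYPE('i))"
  proof (intro equalityI subsetI)
    fix T assume "T \<in> ?M"
    then show "T \<in> difference_set (Lpos_oc TYPE('i)) (Lpos_oc TYPE('i))"
      using decomp[of T]
      by (auto simp: difference_set_def pos vanishing_difference_def fun_diff_def)
  next
    fix T :: "'x \<Rightarrow> 'y" assume "T \<in> difference_set (Lpos_oc TYPE('i)) (Lpos_oc TYPE('i))"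
    then obtain P Q where "linear P" "mono P" "vanishing P" "linear Q" "mono Q" "vanishing Q"
      "T = (\<lambda>x. P x - Q x)"
      by (auto simp: difference_set_def pos fun_diff_def)
    then show "T \<in> ?M" using vanishing_diff Lb_set_diff Lb_set_mono by blast
  qed
  show ?thesis
    unfolding o1 o2 o3 tau
    using diff order_ideal_vanishing[OF directed riesz] order_closed_vanishing[OF directed]
    by blast
qed

end
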